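(* Let $f_1,f_2\in L^2(\mu)$ and let $u,w:X\to\mathbb{C}$ be $\mathcal{F}$-measurable functions such that $T=M_wEM_u$ is a bounded WCT operator on $L^2(\mu)$. Suppose that $f_1\otimes f_2$ majorizes $T$. Then for $S\in\mathcal{B}(L^2(\mu))$ the following are equivalent: (i) $S\in\mathcal{D}_T$; (ii) $g\otimes f_2$ majorizes $g\otimes S^*f_2$ for some $g\in L^2(\mu)$; (iii) there exists $M>0$ such that $\left|\int_Xh\,\overline{S^*(f_2)}\,d\mu\right|\le M\left|\int_Xh\,\overline{f_2}\,d\mu\right|$ for all $h\in L^2(\mu)$. Also, $$\mathcal{B}_T=\{S\in\mathcal{B}(L^2(\mu)): f_2\text{ is an eigenvector for }S^*\}=\mathcal{B}_{f_1\otimes f_2}.$$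
   Context: $(X,\mathcal{F},\mu)$ is a complete $\sigma$-finite measure space, $\mathcal{A}\subseteq\mathcal{F}$ is a $\sigma$-subalgebra such that $(X,\mathcal{A},\mu|_{\mathcal{A}})$ is also $\sigma$-finite, and $L^2(\mu)=L^2(\mathcal{F})=L^2(X,\mathcal{F},\mu)$ (complex-valued functions, $\langle f,g\rangle=\int_Xf\bar g\,d\mu$). $E=E^{\mathcal{A}}$ is the conditional expectation with respect to $\mathcal{A}$: for $f\ge0$ or $f\in L^2(\mathcal{F})$, $E(f)$ is the unique $\mathcal{A}$-measurable function with $\int_AE(f)\,d\mu=\int_Af\,d\mu$ for all $A\in\mathcal{A}$ (a measurable function is called conditionable if its conditional expectation exists). For $\mathcal{F}$-measurable $u,w:X\to\mathbb{C}$ such that, for all $f\in L^2(\mathcal{F})$, $uf$ is conditionable and $wE(uf)\in L^2(\mathcal{F})$, the weighted conditional type (WCT) operator is $M_wEM_u:L^2(\mathcal{F})\to L^2(\mathcal{F})$, $f\mapsto wE(uf)$. For $x,y$ in a Hilbert space $\mathcal{H}$, $x\otimes y$ is the operator $(x\otimes y)h=\langle h,y\rangle x$. For bounded operators $T,S$ on $\mathcal{H}$, $T$ majorizes $S$ if there is $M>0$ with $\|Sx\|\le M\|Tx\|$ for all $x\in\mathcal{H}$. The Deddens algebra $\mathcal{D}_T$ is the set of all $S\in\mathcal{B}(\mathcal{H})$ for which there is $M>0$ with $\|T^nSx\|\le M\|T^nx\|$ for all $n\in\mathbb{N}$, $x\in\mathcal{H}$. Let $r(T)$ be the spectral radius of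 $T$; for integers $m\ge1$ put $d_m=\frac{1}{1/m+r(T)}$ and $R_m=\left(\sum_{n=0}^{\infty}d_m^{2n}T^{*n}T^n\right)^{1/2}$ (the series converges in norm and $R_m$ is positive and invertible). The spectral radius algebra $\mathcal{B}_T$ is the set of all $S\in\mathcal{B}(\mathcal{H})$ with $\sup_{m\in\mathbb{N}}\|R_mSR_m^{-1}\|<\infty$.
   Formalization: The formal statement assumes T is nonzero and requires g to be nonzero in (ii): for T = 0, f_2 nonzero and dim L^2 at least 2, D_T = B_T = B(L^2) while (iii) and the eigenvector condition fail for some S; with g = 0, (ii) holds for every S. *)

theory Defs
  imports "HOL-Probability.Conditional_Expectation" "HOL-Analysis.Complete_Measure"
begin

section \<open>The Hilbert space of square-integrable complex functions\<close>

text \<open>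
  Vectors are represented by square-integrable functions rather than by classes modulo a.e.
  equality, and operators act on such representatives. Every notion below is stated through norms,
  inner products or a.e. equality, so that it only depends on the classes.
\<close>

definition L2 :: "'a measure \<Rightarrow> ('a \<Rightarrow> complex) set" where
  "L2 M = {f \<in> borel_measurable M. integrable M (\<lambda>x. (cmod (f x))\<^sup>2)}"

definition L2_inner :: "'a measure \<Rightarrow> ('a \<Rightarrow> complex) \<Rightarrow> ('a \<Rightarrow> complex) \<Rightarrow> complex" where
  "L2_inner M f g = (LINT x|M. f x * cnj (g x))"

definition L2_norm :: "'a measure \<Rightarrow> ('a \<Rightarrow> complex) \<Rightarrow> real" where
  "L2_norm M f = sqrt (LINT x|M. (cmod (f x))\<^sup>2)"

definition L2_eq :: "'a measure \<Rightarrow> ('a \<Rightarrow> complex) \<Rightarrow> ('a \<Rightarrow> complex) \<Rightarrow> bool" where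
  "L2_eq M f g \<longleftrightarrow> (AE x in M. f x = g x)"

type_synonym 'a L2_map = "('a \<Rightarrow> complex) \<Rightarrow> ('a \<Rightarrow> complex)"

text \<open>
  The bounded linear operators. Linearity up to null sets together with the norm bound implies
  that a.e. equal functions have a.e. equal images. Values outside \<open>L2 M\<close> are irrelevant.
\<close>

definition L2_bounded_ops :: "'a measure \<Rightarrow> 'a L2_map set" where
  "L2_bounded_ops M = {S.
     (\<forall>f\<in>L2 M. S f \<in> L2 M) \<and>
     (\<forall>f\<in>L2 M. \<forall>g\<in>L2 M. L2_eq M (S (\<lambda>x. f x + g x)) (\<lambda>x. S f x + S g x)) \<and>
     (\<forall>c. \<forall>f\<in>L2 M. L2_eq M (S (\<lambda>x. c * f x)) (\<lambda>x. c * S f x)) \<and>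
     (\<exists>C. \<forall>f\<in>L2 M. L2_norm M (S f) \<le> C * L2_norm M f)}"

definition L2_op_eq :: "'a measure \<Rightarrow> 'a L2_map \<Rightarrow> 'a L2_map \<Rightarrow> bool" where
  "L2_op_eq M S T \<longleftrightarrow> (\<forall>f\<in>L2 M. L2_eq M (S f) (T f))"

definition L2_onorm :: "'a measure \<Rightarrow> 'a L2_map \<Rightarrow> real" where
  "L2_onorm M S = (SUP f\<in>{f \<in> L2 M. L2_norm M f \<le> 1}. L2_norm M (S f))"

text \<open>
  The operators chosen with \<open>SOME\<close> below are unique up to \<open>L2_op_eq\<close> whenever they exist.
\<close>

definition L2_adjoint :: "'a measure \<Rightarrow> 'a L2_map \<Rightarrow> 'a L2_map" where
  "L2_adjoint M S = (SOME S'. S' \<in> L2_bounded_ops M \<and>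
     (\<forall>f\<in>L2 M. \<forall>g\<in>L2 M. L2_inner M (S f) g = L2_inner M f (S' g)))"

definition L2_is_inverse :: "'a measure \<Rightarrow> 'a L2_map \<Rightarrow> 'a L2_map \<Rightarrow> bool" where
  "L2_is_inverse M S S' \<longleftrightarrow>
     S' \<in> L2_bounded_ops M \<and> L2_op_eq M (S \<circ> S') id \<and> L2_op_eq M (S' \<circ> S) id"

definition L2_inverse :: "'a measure \<Rightarrow> 'a L2_map \<Rightarrow> 'a L2_map" where
  "L2_inverse M S = (SOME S'. L2_is_inverse M S S')"

definition L2_positive :: "'a measure \<Rightarrow> 'a L2_map \<Rightarrow> bool" where
  "L2_positive M S \<longleftrightarrow>
     S \<in> L2_bounded_ops M \<and> (\<forall>f\<in>L2 M. L2_inner M (S f) f \<in> \<real> \<and> 0 \<le> Re (L2_inner M (S f) f))"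

definition L2_op_sqrt :: "'a measure \<Rightarrow> 'a L2_map \<Rightarrow> 'a L2_map" where
  "L2_op_sqrt M A = (SOME R. L2_positive M R \<and> L2_op_eq M (R \<circ> R) A)"

definition L2_op_suminf :: "'a measure \<Rightarrow> (nat \<Rightarrow> 'a L2_map) \<Rightarrow> 'a L2_map" where
  "L2_op_suminf M B = (SOME A. A \<in> L2_bounded_ops M \<and>
     (\<lambda>N. L2_onorm M (\<lambda>f x. (\<Sum>n<N. B n f x) - A f x)) \<longlonglongrightarrow> 0)"

definition L2_spectrum :: "'a measure \<Rightarrow> 'a L2_map \<Rightarrow> complex set" where
  "L2_spectrum M T = {z. \<nexists>S'. L2_is_inverse M (\<lambda>f x. T f x - z * f x) S'}"

definition L2_spectral_radius :: "'a measure \<Rightarrow> 'a L2_map \<Rightarrow> real" where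
  "L2_spectral_radius M T = (SUP z\<in>L2_spectrum M T. cmod z)"

definition L2_eigenvector :: "'a measure \<Rightarrow> 'a L2_map \<Rightarrow> ('a \<Rightarrow> complex) \<Rightarrow> bool" where
  "L2_eigenvector M S f \<longleftrightarrow>
     f \<in> L2 M \<and> \<not> L2_eq M f (\<lambda>_. 0) \<and> (\<exists>z. L2_eq M (S f) (\<lambda>x. z * f x))"

definition L2_tensor :: "'a measure \<Rightarrow> ('a \<Rightarrow> complex) \<Rightarrow> ('a \<Rightarrow> complex) \<Rightarrow> 'a L2_map" where
  "L2_tensor M f g = (\<lambda>h x. L2_inner M h g * f x)"

definition L2_majorizes :: "'a measure \<Rightarrow> 'a L2_map \<Rightarrow> 'a L2_map \<Rightarrow> bool" where
  "L2_majorizes M T S \<longleftrightarrow> (\<exists>C>0. \<forall>f\<in>L2 M. L2_norm M (S f) \<le> C * L2_norm M (T f))"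


section \<open>Deddens algebras and spectral radius algebras\<close>

definition L2_Deddens_algebra :: "'a measure \<Rightarrow> 'a L2_map \<Rightarrow> 'a L2_map set" where
  "L2_Deddens_algebra M T = {S \<in> L2_bounded_ops M.
     \<exists>C>0. \<forall>n. \<forall>f\<in>L2 M. L2_norm M ((T ^^ n) (S f)) \<le> C * L2_norm M ((T ^^ n) f)}"

definition L2_sra_d :: "'a measure \<Rightarrow> 'a L2_map \<Rightarrow> nat \<Rightarrow> real" where
  "L2_sra_d M T m = 1 / (1 / real m + L2_spectral_radius M T)"

definition L2_sra_R :: "'a measure \<Rightarrow> 'a L2_map \<Rightarrow> nat \<Rightarrow> 'a L2_map" where
  "L2_sra_R M T m = L2_op_sqrt M (L2_op_suminf M
     (\<lambda>n f x. complex_of_real (L2_sra_d M T m ^ (2 * n)) * (L2_adjoint M T ^^ n) ((T ^^ n) f) x))"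

definition L2_spectral_radius_algebra :: "'a measure \<Rightarrow> 'a L2_map \<Rightarrow> 'a L2_map set" where
  "L2_spectral_radius_algebra M T = {S \<in> L2_bounded_ops M.
     bdd_above ((\<lambda>m. L2_onorm M (L2_sra_R M T m \<circ> S \<circ> L2_inverse M (L2_sra_R M T m))) ` {1..})}"


section \<open>Weighted conditional type operators\<close>

text \<open>
  The conditional expectation of a nonnegative function exists with values in \<open>[0, \<infinity>]\<close>. A complex
  function has a complex-valued one, assembled from those of the positive and negative parts of
  its real and imaginary parts, if all four are finite a.e., equivalently if that of the modulus is
  finite a.e. This holds in particular for all elements of \<open>L2 M\<close> when \<open>F\<close> is sigma-finite,
  although these need not be integrable.
\<close>

definition conditionable :: "'a measure \<Rightarrow> 'a measure \<Rightarrow> ('a \<Rightarrow> complex) \<Rightarrow> bool" where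
  "conditionable M F f \<longleftrightarrow>
     f \<in> borel_measurable M \<and> (AE x in M. nn_cond_exp M F (\<lambda>y. ennreal (cmod (f y))) x < \<infinity>)"

definition complex_cond_exp :: "'a measure \<Rightarrow> 'a measure \<Rightarrow> ('a \<Rightarrow> complex) \<Rightarrow> ('a \<Rightarrow> complex)" where
  "complex_cond_exp M F f =
     (\<lambda>x. Complex (real_cond_exp M F (\<lambda>y. Re (f y)) x) (real_cond_exp M F (\<lambda>y. Im (f y)) x))"

definition wct_op ::
  "'a measure \<Rightarrow> 'a measure \<Rightarrow> ('a \<Rightarrow> complex) \<Rightarrow> ('a \<Rightarrow> complex) \<Rightarrow> 'a L2_map" where
  "wct_op M F w u = (\<lambda>f x. w x * complex_cond_exp M F (\<lambda>y. u y * f y) x)"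

definition wct_admissible ::
  "'a measure \<Rightarrow> 'a measure \<Rightarrow> ('a \<Rightarrow> complex) \<Rightarrow> ('a \<Rightarrow> complex) \<Rightarrow> bool" where
  "wct_admissible M F w u \<longleftrightarrow>
     w \<in> borel_measurable M \<and> u \<in> borel_measurable M \<and>
     (\<forall>f\<in>L2 M. conditionable M F (\<lambda>x. u x * f x) \<and> wct_op M F w u f \<in> L2 M)"

end

theory Submission
  imports Defs
begin

text \<open>
  If \<open>f\<^sub>1 \<otimes> f\<^sub>2\<close> majorizes \<open>T \<noteq> 0\<close>, then \<open>T\<close> vanishes on the complement of \<open>f\<^sub>2\<close>, so
  \<open>T = g \<otimes> f\<^sub>2\<close> with \<open>g \<noteq> 0\<close>. The powers \<open>T\<^sup>n\<close> are multiples of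
  \<open>T\<close>, hence only \<open>n = 0\<close> and \<open>n = 1\<close> matter in the Deddens algebra. With \<open>r = |\<langle>g, f\<^sub>2\<rangle>|\<close>, the spectral
  radius, the series defining \<open>R\<^sub>m\<^sup>2\<close> sums to \<open>I + t\<^sub>m f\<^sub>2 \<otimes> f\<^sub>2\<close> with
  \<open>t\<^sub>m = \<parallel>g\<parallel>\<^sup>2 / ((1/m + r)\<^sup>2 - r\<^sup>2) \<rightarrow> \<infinity>\<close>. So \<open>R\<^sub>m\<close> is the identity on the complement of \<open>f\<^sub>2\<close> and
  multiplies \<open>f\<^sub>2\<close> by a factor tending to infinity, and \<open>R\<^sub>m S R\<^sub>m\<^sup>-\<^sup>1\<close> stays bounded exactly when \<open>S\<close>
  preserves this complement, i.e. when \<open>f\<^sub>2\<close> is an eigenvector of \<open>S\<^sup>*\<close>.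
\<close>

section \<open>The pre-Hilbert space structure\<close>

text \<open>In the splitting of the space into the line of \<open>e\<close> (that is, of
  \<open>f2\<close>) and its complement, conjugation by the root leaves the diagonal entries of
  \<open>S\<close> alone. It divides the entry from \<open>e\<close> to the complement by the factor
  on \<open>e\<close>, and multiplies the entry from the complement to \<open>e\<close> by it. Only
  the last one can blow up, which is why a one-sided invariance, and not commutation, is the
  criterion. The adjoint, the sum of the series, the root and the inverse are all picked by
  \<open>SOME\<close> and are determined only up to a.e. equality. Each therefore needs an existence
  proof and a uniqueness proof before it can be replaced by a formula. For the adjoint this means
  the Riesz theorem, hence completeness. The other three stay inside the family
  \<open>L2_shift M e c\<close>, i.e. \<open>I + c (e tensor e)\<close>: there an operator is
  governed by its eigenvalue \<open>1 + c * N\<close> on \<open>e\<close>, with \<open>N\<close> the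
  squared norm of \<open>e\<close>, so that products, roots and inverses become scalar computations
  and no functional calculus is needed.\<close>

lemma L2_integrable: "f \<in> L2 M \<Longrightarrow> integrable M (\<lambda>x. (cmod (f x))\<^sup>2)"
  by (simp add: L2_def)

lemma L2_zero[simp]: "(\<lambda>x. 0) \<in> L2 M"
  by (simp add: L2_def)

lemma L2_scale[simp]: "f \<in> L2 M \<Longrightarrow> (\<lambda>x. c * f x) \<in> L2 M"
  using borel_measurable_times[of "\<lambda>x. c" M f]
  by (simp add: L2_def norm_mult power_mult_distrib)

lemma L2_add[simp]:
  assumes "f \<in> L2 M" "g \<in> L2 M"
  shows "(\<lambda>x. f x + g x) \<in> L2 M"
proof -
  have [measurable]: "f \<in> borel_measurable M" "g \<in> borel_measurable M"
    using assms by (auto simp: L2_def)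
  have le: "(cmod (a + b))\<^sup>2 \<le> 2 * (cmod a)\<^sup>2 + 2 * (cmod b)\<^sup>2" for a b
  proof -
    have "(cmod (a + b))\<^sup>2 \<le> (cmod a + cmod b)\<^sup>2"
      by (intro power_mono norm_triangle_ineq) auto
    also have "\<dots> \<le> 2 * (cmod a)\<^sup>2 + 2 * (cmod b)\<^sup>2"
      using sum_squares_bound[of "cmod a" "cmod b"] by (simp add: power2_sum)
    finally show ?thesis .
  qed
  have "integrable M (\<lambda>x. 2 * (cmod (f x))\<^sup>2 + 2 * (cmod (g x))\<^sup>2)"
    using assms by (auto simp: L2_def)
  then have "integrable M (\<lambda>x. (cmod (f x + g x))\<^sup>2)"
    by (rule Bochner_Integration.integrable_bound) (auto simp: le)
  then show ?thesis by (simp add: L2_def)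
qed

lemma L2_diff[simp]:
  assumes "f \<in> L2 M" "g \<in> L2 M"
  shows "(\<lambda>x. f x - g x) \<in> L2 M"
  using L2_add[OF assms(1) L2_scale[OF assms(2), of "-1"]] by simp

lemma L2_sum[simp]: "(\<And>i. i \<in> I \<Longrightarrow> f i \<in> L2 M) \<Longrightarrow> (\<lambda>x. \<Sum>i\<in>I. f i x) \<in> L2 M"
  by (induction I rule: infinite_finite_induct) auto

lemma L2_mult_integrable:
  assumes "f \<in> L2 M" "g \<in> L2 M"
  shows "integrable M (\<lambda>x. f x * cnj (g x))"
proof -
  have [measurable]: "f \<in> borel_measurable M" "g \<in> borel_measurable M"
    using assms by (auto simp: L2_def)
  have [measurable]: "(\<lambda>x. cnj (g x)) \<in> borel_measurable M"
    by (rule borel_measurable_continuous_on[of cnj]) (auto intro: continuous_intros)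
  have "integrable M (\<lambda>x. (cmod (f x))\<^sup>2 + (cmod (g x))\<^sup>2)"
    using assms by (auto simp: L2_def)
  moreover have "cmod (a * cnj b) \<le> (cmod a)\<^sup>2 + (cmod b)\<^sup>2" for a b
    using sum_squares_bound[of "cmod a" "cmod b"] mult_nonneg_nonneg[of "cmod a" "cmod b"]
    by (simp add: norm_mult del: mult_nonneg_nonneg)
  ultimately show ?thesis
    by (rule_tac Bochner_Integration.integrable_bound) (auto intro!: AE_I2)
qed

lemma L2_inner_commute: "L2_inner M g f = cnj (L2_inner M f g)"
  unfolding L2_inner_def
  by (subst Bochner_Integration.integral_cnj[symmetric]) (simp add: mult.commute)

lemma L2_inner_add_left[simp]:
  "f \<in> L2 M \<Longrightarrow> g \<in> L2 M \<Longrightarrow> h \<in> L2 M \<Longrightarrow>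
    L2_inner M (\<lambda>x. f x + g x) h = L2_inner M f h + L2_inner M g h"
  by (simp add: L2_inner_def distrib_right L2_mult_integrable)

lemma L2_inner_diff_left[simp]:
  "f \<in> L2 M \<Longrightarrow> g \<in> L2 M \<Longrightarrow> h \<in> L2 M \<Longrightarrow>
    L2_inner M (\<lambda>x. f x - g x) h = L2_inner M f h - L2_inner M g h"
  by (simp add: L2_inner_def left_diff_distrib L2_mult_integrable)

lemma L2_inner_scale_left[simp]: "L2_inner M (\<lambda>x. c * f x) h = c * L2_inner M f h"
  by (simp add: L2_inner_def mult.assoc)

lemma L2_inner_add_right[simp]:
  "f \<in> L2 M \<Longrightarrow> g \<in> L2 M \<Longrightarrow> h \<in> L2 M \<Longrightarrow>
    L2_inner M h (\<lambda>x. f x + g x) = L2_inner M h f + L2_inner M h g"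
  using L2_inner_commute[of M h "\<lambda>x. f x + g x"] L2_inner_commute[of M h f]
    L2_inner_commute[of M h g] by simp

lemma L2_inner_diff_right[simp]:
  "f \<in> L2 M \<Longrightarrow> g \<in> L2 M \<Longrightarrow> h \<in> L2 M \<Longrightarrow>
    L2_inner M h (\<lambda>x. f x - g x) = L2_inner M h f - L2_inner M h g"
  using L2_inner_commute[of M h "\<lambda>x. f x - g x"] L2_inner_commute[of M h f]
    L2_inner_commute[of M h g] by simp

lemma L2_inner_scale_right[simp]: "L2_inner M h (\<lambda>x. c * f x) = cnj c * L2_inner M h f"
  using L2_inner_commute[of M h "\<lambda>x. c * f x"] L2_inner_commute[of M h f] by simp

lemma L2_inner_zero_right[simp]: "L2_inner M h (\<lambda>x. 0) = 0"
  by (simp add: L2_inner_def)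

lemma L2_norm_nonneg[simp]: "0 \<le> L2_norm M f"
  by (simp add: L2_norm_def)

lemma L2_inner_self: "L2_inner M f f = complex_of_real ((L2_norm M f)\<^sup>2)"
proof -
  have "L2_inner M f f = (LINT x|M. complex_of_real ((cmod (f x))\<^sup>2))"
    by (simp add: L2_inner_def complex_norm_square[symmetric] del: of_real_power)
  then show ?thesis
    by (simp only: integral_complex_of_real) (simp add: L2_norm_def)
qed

lemma L2_norm_sq: "(L2_norm M f)\<^sup>2 = Re (L2_inner M f f)"
  by (simp add: L2_inner_self)

lemma L2_norm_scale[simp]: "L2_norm M (\<lambda>x. c * f x) = cmod c * L2_norm M f"
  by (simp add: L2_norm_def norm_mult power_mult_distrib real_sqrt_mult)

lemma L2_norm_zero[simp]: "L2_norm M (\<lambda>x. 0) = 0"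
  by (simp add: L2_norm_def)

lemma L2_norm_diff_eq_0_iff:
  assumes "f \<in> L2 M" "g \<in> L2 M"
  shows "L2_norm M (\<lambda>x. f x - g x) = 0 \<longleftrightarrow> L2_eq M f g"
  using L2_integrable[OF L2_diff[OF assms]]
  by (simp add: L2_norm_def L2_eq_def integral_nonneg_eq_0_iff_AE)

lemma L2_norm_eq_0_iff: "f \<in> L2 M \<Longrightarrow> L2_norm M f = 0 \<longleftrightarrow> L2_eq M f (\<lambda>x. 0)"
  using L2_norm_diff_eq_0_iff[of f M "\<lambda>x. 0"] by simp

lemma L2_eq_refl[simp]: "L2_eq M f f"
  by (simp add: L2_eq_def)

lemma L2_eq_sym: "L2_eq M f g \<Longrightarrow> L2_eq M g f"
  by (auto simp: L2_eq_def)

lemma L2_eq_trans[trans]: "L2_eq M f g \<Longrightarrow> L2_eq M g h \<Longrightarrow> L2_eq M f h"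
  by (auto simp: L2_eq_def)

lemma L2_eq_add:
  "L2_eq M f f' \<Longrightarrow> L2_eq M g g' \<Longrightarrow> L2_eq M (\<lambda>x. f x + g x) (\<lambda>x. f' x + g' x)"
  by (auto simp: L2_eq_def)

lemma L2_eq_diff:
  "L2_eq M f f' \<Longrightarrow> L2_eq M g g' \<Longrightarrow> L2_eq M (\<lambda>x. f x - g x) (\<lambda>x. f' x - g' x)"
  by (auto simp: L2_eq_def)

lemma L2_eq_scale: "L2_eq M f f' \<Longrightarrow> L2_eq M (\<lambda>x. c * f x) (\<lambda>x. c * f' x)"
  by (auto simp: L2_eq_def)

lemma L2_inner_cong:
  assumes "L2_eq M f f'" "L2_eq M g g'" "f \<in> L2 M" "f' \<in> L2 M" "g \<in> L2 M" "g' \<in> L2 M"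
  shows "L2_inner M f g = L2_inner M f' g'"
proof -
  have "AE x in M. f x * cnj (g x) = f' x * cnj (g' x)"
    using assms(1,2) by (auto simp: L2_eq_def)
  moreover have "(\<lambda>x. f x * cnj (g x)) \<in> borel_measurable M"
    "(\<lambda>x. f' x * cnj (g' x)) \<in> borel_measurable M"
    using assms(3-) by (simp_all only: borel_measurable_integrable[OF L2_mult_integrable])
  ultimately show ?thesis
    unfolding L2_inner_def by (rule integral_cong_AE[rotated 2])
qed

lemma L2_norm_cong:
  assumes "L2_eq M f f'" "f \<in> L2 M" "f' \<in> L2 M"
  shows "L2_norm M f = L2_norm M f'"
proof -
  have "(L2_norm M f)\<^sup>2 = (L2_norm M f')\<^sup>2"
    by (simp only: L2_norm_sq L2_inner_cong[OF assms(1,1,2,3,2,3)])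
  then show ?thesis by (rule power2_eq_imp_eq) simp_all
qed

text \<open>Testing against the difference \<open>f - g\<close> itself makes its norm vanish. This
  is how identities for adjoints become a.e. identities.\<close>

lemma L2_eq_iff_inner:
  assumes "f \<in> L2 M" "g \<in> L2 M"
  shows "L2_eq M f g \<longleftrightarrow> (\<forall>h\<in>L2 M. L2_inner M h f = L2_inner M h g)"
proof
  let ?d = "\<lambda>x. f x - g x"
  assume "\<forall>h\<in>L2 M. L2_inner M h f = L2_inner M h g"
  then have "L2_inner M ?d f = L2_inner M ?d g"
    by (rule bspec) (use assms in simp)
  then have "L2_inner M ?d ?d = 0"
    using assms by (subst L2_inner_diff_right) simp_all
  then have "(L2_norm M ?d)\<^sup>2 = 0"
    by (simp add: L2_norm_sq)
  then show "L2_eq M f g"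
    using L2_norm_diff_eq_0_iff[OF assms] by simp
next
  assume "L2_eq M f g"
  then show "\<forall>h\<in>L2 M. L2_inner M h f = L2_inner M h g"
    using L2_inner_cong[OF L2_eq_refl] assms by metis
qed

lemma L2_Cauchy_Schwarz:
  assumes f: "f \<in> L2 M" and g: "g \<in> L2 M"
  shows "cmod (L2_inner M f g) \<le> L2_norm M f * L2_norm M g"
proof (cases "L2_norm M g = 0")
  case True
  then have "L2_inner M f g = L2_inner M f (\<lambda>x. 0)"
    using f g by (intro L2_inner_cong) (auto simp: L2_norm_eq_0_iff)
  with True show ?thesis by simp
next
  case False
  \<comment> \<open>\<open>c * g\<close> is the orthogonal projection of \<open>f\<close> to the
    line of \<open>g\<close>; the inequality says that the squared distance from \<open>f\<close> to
    it is nonnegative.\<close>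
  define c where "c = L2_inner M f g / complex_of_real ((L2_norm M g)\<^sup>2)"
  have c: "c * complex_of_real ((L2_norm M g)\<^sup>2) = L2_inner M f g"
    using False by (simp add: c_def)
  have "complex_of_real ((L2_norm M (\<lambda>x. f x - c * g x))\<^sup>2) = complex_of_real ((L2_norm M f)\<^sup>2) - cnj c * L2_inner M f g
      - c * cnj (L2_inner M f g) + cnj c * (c * complex_of_real ((L2_norm M g)\<^sup>2))"
    using f g L2_inner_commute[of M g f]
    by (simp add: L2_inner_self[symmetric] algebra_simps del: of_real_power)
  also have "\<dots> = complex_of_real ((L2_norm M f)\<^sup>2 - (cmod (L2_inner M f g))\<^sup>2 / (L2_norm M g)\<^sup>2)"
    unfolding c by (simp add: c_def complex_norm_square[symmetric] mult.commute del: of_real_power)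
  finally have "(L2_norm M (\<lambda>x. f x - c * g x))\<^sup>2
      = (L2_norm M f)\<^sup>2 - (cmod (L2_inner M f g))\<^sup>2 / (L2_norm M g)\<^sup>2"
    by (simp only: of_real_eq_iff)
  then have "(cmod (L2_inner M f g))\<^sup>2 / (L2_norm M g)\<^sup>2 \<le> (L2_norm M f)\<^sup>2"
    using zero_le_power2[of "L2_norm M (\<lambda>x. f x - c * g x)"] by linarith
  then have "(cmod (L2_inner M f g))\<^sup>2 \<le> (L2_norm M f * L2_norm M g)\<^sup>2"
    using False by (simp add: divide_le_eq power_mult_distrib)
  then show ?thesis by (rule power2_le_imp_le) simp
qed

lemma L2_triangle:
  assumes f: "f \<in> L2 M" and g: "g \<in> L2 M"
  shows "L2_norm M (\<lambda>x. f x + g x) \<le> L2_norm M f + L2_norm M g"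
proof -
  have "(L2_norm M (\<lambda>x. f x + g x))\<^sup>2
      = (L2_norm M f)\<^sup>2 + (L2_norm M g)\<^sup>2 + 2 * Re (L2_inner M f g)"
    using f g L2_inner_commute[of M g f] by (simp add: L2_norm_sq)
  also have "Re (L2_inner M f g) \<le> L2_norm M f * L2_norm M g"
    using L2_Cauchy_Schwarz[OF f g] complex_Re_le_cmod[of "L2_inner M f g"] by linarith
  finally have "(L2_norm M (\<lambda>x. f x + g x))\<^sup>2 \<le> (L2_norm M f + L2_norm M g)\<^sup>2"
    by (simp add: power2_sum)
  then show ?thesis by (rule power2_le_imp_le) simp
qed

lemma L2_triangle_diff:
  assumes f: "f \<in> L2 M" and g: "g \<in> L2 M"
  shows "L2_norm M (\<lambda>x. f x - g x) \<le> L2_norm M f + L2_norm M g"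
  using L2_triangle[OF f L2_scale[OF g, of "-1"]] L2_norm_scale[of M "-1" g] by simp

section \<open>Completeness and the Riesz representation theorem\<close>

text \<open>
  Multiplying by a strictly positive square-integrable weight turns a Cauchy sequence in \<open>L\<^sup>2\<close> into
  one in \<open>L\<^sup>1\<close>, which yields an a.e. convergent subsequence.
\<close>

lemma L2_complete:
  fixes s :: "nat \<Rightarrow> 'a \<Rightarrow> complex"
  assumes "sigma_finite_measure M" and s: "\<And>n. s n \<in> L2 M"
    and cau: "\<And>e. e > 0 \<Longrightarrow> \<exists>N. \<forall>i\<ge>N. \<forall>j\<ge>N. L2_norm M (\<lambda>x. s i x - s j x) < e"
  obtains f where "f \<in> L2 M" "(\<lambda>n. L2_norm M (\<lambda>x. s n x - f x)) \<longlonglongrightarrow> 0"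
proof -
  interpret sigma_finite_measure M by fact
  have [measurable]: "\<And>n. s n \<in> borel_measurable M"
    using s by (auto simp: L2_def)
  obtain p :: "'a \<Rightarrow> real" where [measurable]: "p \<in> borel_measurable M"
    and p: "\<And>x. p x > 0" and ip: "integrable M p"
    by (rule obtain_positive_integrable_function) auto
  \<comment> \<open>The root of an integrable function is square integrable, so Cauchy-Schwarz
    against \<open>q\<close> bounds the L1 norm of \<open>f * q\<close> by the L2 norm of
    \<open>f\<close>.\<close>
  define q where "q x = complex_of_real (sqrt (p x))" for x
  have q_pos: "cmod (q x) > 0" for x using p[of x] by (simp add: q_def)
  have q: "q \<in> L2 M"
    using ip p unfolding L2_def q_def by (simp add: less_imp_le)
  have iq: "integrable M (\<lambda>x. f x * q x)" if "f \<in> L2 M" for f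
    using L2_mult_integrable[OF that q] by (simp add: q_def)
  have le: "(LINT x|M. cmod (f x * q x)) \<le> L2_norm M f * L2_norm M q" if f: "f \<in> L2 M" for f
  proof -
    have [measurable]: "f \<in> borel_measurable M" using f by (auto simp: L2_def)
    have cf: "(\<lambda>x. complex_of_real (cmod (f x))) \<in> L2 M"
      using f by (simp add: L2_def)
    have "(LINT x|M. cmod (f x * q x)) \<le> cmod (complex_of_real (LINT x|M. cmod (f x * q x)))"
      by simp
    also have "complex_of_real (LINT x|M. cmod (f x * q x))
        = L2_inner M (\<lambda>x. complex_of_real (cmod (f x))) q"
      unfolding L2_inner_def integral_complex_of_real[symmetric]
      using p by (intro Bochner_Integration.integral_cong) (auto simp: q_def norm_mult less_imp_le)
    also have "cmod \<dots> \<le> L2_norm M (\<lambda>x. complex_of_real (cmod (f x))) * L2_norm M q"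
      by (rule L2_Cauchy_Schwarz[OF cf q])
    also have "L2_norm M (\<lambda>x. complex_of_real (cmod (f x))) = L2_norm M f"
      by (simp add: L2_norm_def)
    finally show ?thesis .
  qed
  have "\<exists>N. \<forall>i\<ge>N. \<forall>j\<ge>N. (LINT x|M. norm (s i x * q x - s j x * q x)) < e" if "e > 0" for e
  proof -
    \<comment> \<open>The \<open>+ 1\<close> keeps the divisor positive when \<open>M\<close> is the
      null measure and \<open>q\<close> has norm 0.\<close>
    have d: "e / (L2_norm M q + 1) > 0" (is "?d > 0")
      using that by (intro divide_pos_pos) (auto intro: add_nonneg_pos)
    obtain N where N: "\<And>i j. i \<ge> N \<Longrightarrow> j \<ge> N \<Longrightarrow> L2_norm M (\<lambda>x. s i x - s j x) < ?d"
      using cau[OF d] by blast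
    have "(LINT x|M. norm (s i x * q x - s j x * q x)) < e" if "i \<ge> N" "j \<ge> N" for i j
    proof -
      have "(LINT x|M. norm (s i x * q x - s j x * q x))
          \<le> L2_norm M (\<lambda>x. s i x - s j x) * L2_norm M q"
        using le[OF L2_diff[OF s[of i] s[of j]]] by (simp add: left_diff_distrib)
      also have "\<dots> \<le> ?d * L2_norm M q"
        using N[OF that] by (intro mult_right_mono) auto
      also have "\<dots> < ?d * (L2_norm M q + 1)"
        using d by (intro mult_strict_left_mono) auto
      also have "\<dots> = e"
        using add_nonneg_pos[OF L2_norm_nonneg[of M q] zero_less_one] by simp
      finally show ?thesis .
    qed
    then show ?thesis by blast
  qed
  then obtain r where r: "strict_mono r" and ae: "AE x in M. Cauchy (\<lambda>i. s (r i) x * q x)"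
    by (rule cauchy_L1_AE_cauchy_subseq[of M "\<lambda>n x. s n x * q x", OF iq[OF s]])
  define f where "f x = lim (\<lambda>i. s (r i) x)" for x
  have [measurable]: "f \<in> borel_measurable M"
    unfolding f_def by measurable
  have conv: "AE x in M. (\<lambda>i. s (r i) x) \<longlonglongrightarrow> f x"
    using ae
  proof eventually_elim
    case (elim x)
    then obtain l where "(\<lambda>i. s (r i) x * q x) \<longlonglongrightarrow> l"
      by (auto simp: Cauchy_convergent_iff convergent_def)
    from tendsto_divide[OF this tendsto_const[of "q x"]]
    have "(\<lambda>i. s (r i) x) \<longlonglongrightarrow> l / q x"
      using q_pos[of x] by simp
    with limI[OF this] show ?case by (simp add: f_def)
  qed
  have nn: "(\<integral>\<^sup>+x. ennreal ((cmod (h x))\<^sup>2) \<partial>M) = ennreal ((L2_norm M h)\<^sup>2)" if "h \<in> L2 M" for h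
    using that by (subst nn_integral_eq_integral) (auto simp: L2_def L2_norm_def)
  \<comment> \<open>Square integrability of the limit \<open>f\<close> is still open, so the
    estimate is made with nonnegative integrals. Fatou's lemma along the a.e. convergent subsequence
    carries the Cauchy bound over to \<open>f\<close>.\<close>
  have fatou: "(\<integral>\<^sup>+x. ennreal ((cmod (s n x - f x))\<^sup>2) \<partial>M) \<le> ennreal (e\<^sup>2)"
    if "e > 0" and N: "\<And>j. j \<ge> N \<Longrightarrow> L2_norm M (\<lambda>x. s n x - s j x) < e" for n N e
  proof -
    have "(\<integral>\<^sup>+x. ennreal ((cmod (s n x - f x))\<^sup>2) \<partial>M)
        = (\<integral>\<^sup>+x. liminf (\<lambda>k. ennreal ((cmod (s n x - s (r k) x))\<^sup>2)) \<partial>M)"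
    proof (rule nn_integral_cong_AE, use conv in eventually_elim)
      case (elim x)
      then have "(\<lambda>k. ennreal ((cmod (s n x - s (r k) x))\<^sup>2)) \<longlonglongrightarrow> ennreal ((cmod (s n x - f x))\<^sup>2)"
        by (intro tendsto_intros) auto
      then show ?case by (rule lim_imp_Liminf[OF sequentially_bot, symmetric])
    qed
    also have "\<dots> \<le> liminf (\<lambda>k. \<integral>\<^sup>+x. ennreal ((cmod (s n x - s (r k) x))\<^sup>2) \<partial>M)"
      by (rule nn_integral_liminf) measurable
    also have "\<dots> \<le> ennreal (e\<^sup>2)"
    proof (rule Liminf_le)
      have "\<forall>\<^sub>F k in sequentially. k \<ge> N" by (rule eventually_ge_at_top)
      then show "\<forall>\<^sub>F k in sequentially.
          (\<integral>\<^sup>+x. ennreal ((cmod (s n x - s (r k) x))\<^sup>2) \<partial>M) \<le> ennreal (e\<^sup>2)"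
      proof eventually_elim
        case (elim k)
        then have "r k \<ge> N" using seq_suble[OF r, of k] by linarith
        then have "(L2_norm M (\<lambda>x. s n x - s (r k) x))\<^sup>2 \<le> e\<^sup>2"
          using N[of "r k"] by (intro power_mono) auto
        then show ?case using s by (subst nn) (auto intro: ennreal_leI)
      qed
    qed simp
    finally show ?thesis .
  qed
  have mem: "(\<lambda>x. s n x - f x) \<in> L2 M \<and> L2_norm M (\<lambda>x. s n x - f x) \<le> e"
    if "e > 0" and "\<And>j. j \<ge> N \<Longrightarrow> L2_norm M (\<lambda>x. s n x - s j x) < e" for n N e
  proof -
    have b: "(\<integral>\<^sup>+x. ennreal ((cmod (s n x - f x))\<^sup>2) \<partial>M) \<le> ennreal (e\<^sup>2)"
      using fatou that by blast
    have m: "(\<lambda>x. s n x - f x) \<in> L2 M"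
      using le_less_trans[OF b ennreal_less_top] by (simp add: L2_def integrable_iff_bounded)
    then have "ennreal ((L2_norm M (\<lambda>x. s n x - f x))\<^sup>2) \<le> ennreal (e\<^sup>2)"
      using b nn by simp
    then have "(L2_norm M (\<lambda>x. s n x - f x))\<^sup>2 \<le> e\<^sup>2"
      by (subst (asm) ennreal_le_iff) auto
    then have "L2_norm M (\<lambda>x. s n x - f x) \<le> e"
      by (rule power2_le_imp_le) (use \<open>e > 0\<close> in simp)
    with m show ?thesis ..
  qed
  show thesis
  proof (rule that)
    obtain N where N: "\<And>i j. i \<ge> N \<Longrightarrow> j \<ge> N \<Longrightarrow> L2_norm M (\<lambda>x. s i x - s j x) < 1"
      using cau[of 1] by auto
    have "(\<lambda>x. s N x - f x) \<in> L2 M" using mem[of 1 N N] N by auto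
    from L2_diff[OF s[of N] this] show "f \<in> L2 M" by simp
    show "(\<lambda>n. L2_norm M (\<lambda>x. s n x - f x)) \<longlonglongrightarrow> 0"
    proof (rule LIMSEQ_I)
      fix e :: real assume e: "e > 0"
      obtain N where N: "\<And>i j. i \<ge> N \<Longrightarrow> j \<ge> N \<Longrightarrow> L2_norm M (\<lambda>x. s i x - s j x) < e / 2"
        using cau[of "e / 2"] e by auto
      have "norm (L2_norm M (\<lambda>x. s n x - f x) - 0) < e" if "n \<ge> N" for n
        using mem[of "e / 2" N n] N[OF that] e by simp
      then show "\<exists>N. \<forall>n\<ge>N. norm (L2_norm M (\<lambda>x. s n x - f x) - 0) < e" by blast
    qed
  qed
qed

text \<open>The representing vector is the limit of a minimizing sequence of \<open>\<parallel>h\<parallel>\<^sup>2 - 2 Re (\<phi> h)\<close>.\<close>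

lemma L2_Riesz:
  fixes \<phi> :: "('a \<Rightarrow> complex) \<Rightarrow> complex"
  assumes sf: "sigma_finite_measure M"
    and add: "\<And>f g. f \<in> L2 M \<Longrightarrow> g \<in> L2 M \<Longrightarrow> \<phi> (\<lambda>x. f x + g x) = \<phi> f + \<phi> g"
    and scale: "\<And>c f. f \<in> L2 M \<Longrightarrow> \<phi> (\<lambda>x. c * f x) = c * \<phi> f"
    and bound: "\<And>f. f \<in> L2 M \<Longrightarrow> cmod (\<phi> f) \<le> C * L2_norm M f"
  shows "\<exists>k\<in>L2 M. \<forall>h\<in>L2 M. \<phi> h = L2_inner M h k"
proof -
  define J where "J h = (L2_norm M h)\<^sup>2 - 2 * Re (\<phi> h)" for h
  define m where "m = Inf (J ` L2 M)"
  \<comment> \<open>Completing the square: \<open>J h\<close> is at least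
    \<open>(L2_norm M h - C)\<^sup>2 - C\<^sup>2\<close>.\<close>
  have lower: "J h \<ge> - C\<^sup>2" if "h \<in> L2 M" for h
    using bound[OF that] complex_Re_le_cmod[of "\<phi> h"] zero_le_power2[of "L2_norm M h - C"]
    unfolding J_def power2_diff by (simp add: mult.commute)
  have bdd: "bdd_below (J ` L2 M)"
    by (rule bdd_belowI2) (rule lower)
  have m: "m \<le> J h" if "h \<in> L2 M" for h
    unfolding m_def using bdd that by (intro cInf_lower) auto
  have "\<exists>h\<in>L2 M. J h < m + 1 / real (Suc n)" for n
  proof -
    have "J ` L2 M \<noteq> {}" using L2_zero by blast
    moreover have "Inf (J ` L2 M) < m + 1 / real (Suc n)" by (simp add: m_def)
    ultimately have "\<exists>y\<in>J ` L2 M. y < m + 1 / real (Suc n)"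
      by (rule cInf_lessD)
    then show ?thesis by blast
  qed
  then obtain s where s: "\<And>n. s n \<in> L2 M" and Js: "\<And>n. J (s n) < m + 1 / real (Suc n)"
    by metis
  \<comment> \<open>The parallelogram law, with \<open>J\<close> at the midpoint of \<open>f\<close>
    and \<open>g\<close> bounded below by \<open>m\<close>. It makes every minimizing sequence a
    Cauchy sequence.\<close>
  have par: "(L2_norm M (\<lambda>x. f x - g x))\<^sup>2 \<le> 2 * (J f + J g - 2 * m)"
    if f: "f \<in> L2 M" and g: "g \<in> L2 M" for f g
  proof -
    have "m \<le> J (\<lambda>x. c * (f x + g x))" for c
      by (intro m L2_scale L2_add f g)
    then have "m \<le> (cmod c)\<^sup>2 * (L2_norm M (\<lambda>x. f x + g x))\<^sup>2 - 2 * Re (c * (\<phi> f + \<phi> g))" for c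
      by (simp only: J_def scale[OF L2_add[OF f g]] add[OF f g] L2_norm_scale power_mult_distrib)
    from this[of "1/2"]
    have "m \<le> (1/4) * (L2_norm M (\<lambda>x. f x + g x))\<^sup>2 - Re (\<phi> f) - Re (\<phi> g)"
      by (simp add: norm_divide power2_eq_square add_divide_distrib)
    moreover have "(L2_norm M (\<lambda>x. f x + g x))\<^sup>2 + (L2_norm M (\<lambda>x. f x - g x))\<^sup>2
        = 2 * (L2_norm M f)\<^sup>2 + 2 * (L2_norm M g)\<^sup>2"
      using f g by (simp add: L2_norm_sq)
    ultimately show ?thesis unfolding J_def by argo
  qed
  have "\<exists>N. \<forall>i\<ge>N. \<forall>j\<ge>N. L2_norm M (\<lambda>x. s i x - s j x) < e" if e: "e > 0" for e
  proof -
    \<comment> \<open>By \<open>par\<close>, two members beyond \<open>N\<close> have squared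
      distance below \<open>4 / real (Suc N)\<close>.\<close>
    obtain N where N: "1 / real (Suc N) < e\<^sup>2 / 4"
      using reals_Archimedean[of "e\<^sup>2 / 4"] e by (auto simp: inverse_eq_divide)
    have "L2_norm M (\<lambda>x. s i x - s j x) < e" if "i \<ge> N" "j \<ge> N" for i j
    proof -
      have le: "1 / real (Suc i) \<le> 1 / real (Suc N)" "1 / real (Suc j) \<le> 1 / real (Suc N)"
        using that by (auto intro!: divide_left_mono)
      have "(L2_norm M (\<lambda>x. s i x - s j x))\<^sup>2 < e\<^sup>2"
        using par[OF s[of i] s[of j]] Js[of i] Js[of j] N le by argo
      then show ?thesis
        by (rule power2_less_imp_less) (use e in simp)
    qed
    then show ?thesis by blast
  qed
  from L2_complete[OF sf s this] obtain k where k: "k \<in> L2 M"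
    and lim: "(\<lambda>n. L2_norm M (\<lambda>x. s n x - k x)) \<longlonglongrightarrow> 0" by blast
  show ?thesis
  proof (intro bexI[OF _ k] ballI)
    fix h assume h: "h \<in> L2 M"
    have inner_lim: "(\<lambda>n. L2_inner M h (s n)) \<longlonglongrightarrow> L2_inner M h k"
    proof (rule Lim_null_comparison[THEN LIM_zero_cancel])
      show "\<forall>\<^sub>F n in sequentially. norm (L2_inner M h (s n) - L2_inner M h k)
          \<le> L2_norm M h * L2_norm M (\<lambda>x. s n x - k x)"
        using L2_Cauchy_Schwarz[OF h L2_diff[OF s k]] h s k by simp
      show "(\<lambda>n. L2_norm M h * L2_norm M (\<lambda>x. s n x - k x)) \<longlonglongrightarrow> 0"
        using tendsto_mult_right_zero[OF lim] by simp
    qed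
    \<comment> \<open>The first-order condition at the minimum, in the direction
      \<open>t * h\<close>. It is derived for the near-minimizers \<open>s n\<close> with error
      \<open>1 / real (Suc n)\<close>, so that only the inner products with the fixed
      \<open>h\<close> have to pass to the limit.\<close>
    have var: "2 * Re (t * (\<phi> h - L2_inner M h k)) \<le> (cmod t)\<^sup>2 * (L2_norm M h)\<^sup>2" for t
    proof (rule LIMSEQ_le)
      have *: "2 * Re (t * (\<phi> h - L2_inner M h (s n)))
          \<le> (cmod t)\<^sup>2 * (L2_norm M h)\<^sup>2 + 1 / real (Suc n)" for n
      proof -
        have "m \<le> J (\<lambda>x. s n x + t * h x)" by (intro m L2_scale L2_add s h)
        also have "\<dots> = J (s n) + (cmod t)\<^sup>2 * (L2_norm M h)\<^sup>2
            - 2 * Re (t * (\<phi> h - L2_inner M h (s n)))"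
        proof -
          have "(L2_norm M (\<lambda>x. s n x + t * h x))\<^sup>2
              = (L2_norm M (s n))\<^sup>2 + (L2_norm M (\<lambda>x. t * h x))\<^sup>2 + 2 * Re (t * L2_inner M h (s n))"
            using s[of n] h L2_inner_commute[of M "s n" h]
            by (simp add: L2_norm_sq algebra_simps del: L2_norm_scale)
          then show ?thesis
            unfolding J_def add[OF s L2_scale[OF h]] scale[OF h]
            by (simp add: power_mult_distrib algebra_simps)
        qed
        finally show ?thesis using Js[of n] by linarith
      qed
      show "(\<lambda>n. 2 * Re (t * (\<phi> h - L2_inner M h (s n))))
          \<longlonglongrightarrow> 2 * Re (t * (\<phi> h - L2_inner M h k))"
        by (intro tendsto_intros inner_lim)
      show "(\<lambda>n. (cmod t)\<^sup>2 * (L2_norm M h)\<^sup>2 + 1 / real (Suc n)) \<longlonglongrightarrow> (cmod t)\<^sup>2 * (L2_norm M h)\<^sup>2"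
        using tendsto_add[OF tendsto_const LIMSEQ_inverse_real_of_nat] by (simp add: inverse_eq_divide)
      show "\<exists>N. \<forall>n\<ge>N. 2 * Re (t * (\<phi> h - L2_inner M h (s n)))
          \<le> (cmod t)\<^sup>2 * (L2_norm M h)\<^sup>2 + 1 / real (Suc n)"
        using * by blast
    qed
    show "\<phi> h = L2_inner M h k"
    proof (rule ccontr)
      assume ne: "\<phi> h \<noteq> L2_inner M h k"
      define z where "z = \<phi> h - L2_inner M h k"
      \<comment> \<open>With \<open>t = e * cnj z\<close> the left side of \<open>var\<close> is
        linear in \<open>e\<close> and the right side quadratic. This \<open>e\<close> is small
        enough for the linear term to win, also when \<open>h\<close> has norm 0.\<close>
      define e where "e = 1 / ((L2_norm M h)\<^sup>2 + 1)"
      have z: "cmod z > 0" using ne by (simp add: z_def)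
      have e: "e > 0" "e * (L2_norm M h)\<^sup>2 < 1"
        unfolding e_def by (auto simp: divide_simps add_nonneg_pos add_nonneg_eq_0_iff)
      have re: "complex_of_real e * cnj z * z = complex_of_real (e * (cmod z)\<^sup>2)"
        by (simp only: of_real_mult complex_norm_square) (simp add: mult_ac)
      have "2 * (e * (cmod z)\<^sup>2) \<le> (cmod (complex_of_real e * cnj z))\<^sup>2 * (L2_norm M h)\<^sup>2"
        using var[of "complex_of_real e * cnj z", folded z_def] unfolding re Re_complex_of_real .
      also have "cmod (complex_of_real e * cnj z) = e * cmod z"
        using e by (simp add: norm_mult)
      finally have "2 * (e * (cmod z)\<^sup>2) \<le> (e * cmod z)\<^sup>2 * (L2_norm M h)\<^sup>2" .
      also have "\<dots> = e * (cmod z)\<^sup>2 * (e * (L2_norm M h)\<^sup>2)"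
        by (simp add: power2_eq_square)
      also have "\<dots> \<le> e * (cmod z)\<^sup>2 * 1"
        using e by (intro mult_left_mono) auto
      finally have "e * (cmod z)\<^sup>2 \<le> 0" by simp
      moreover have "e * (cmod z)\<^sup>2 > 0" using e z by simp
      ultimately show False by simp
    qed
  qed
qed

section \<open>Bounded operators\<close>

lemma L2_bounded_ops_L2: "S \<in> L2_bounded_ops M \<Longrightarrow> f \<in> L2 M \<Longrightarrow> S f \<in> L2 M"
  by (simp add: L2_bounded_ops_def)

lemma L2_bounded_ops_add:
  "S \<in> L2_bounded_ops M \<Longrightarrow> f \<in> L2 M \<Longrightarrow> g \<in> L2 M \<Longrightarrow>
    L2_eq M (S (\<lambda>x. f x + g x)) (\<lambda>x. S f x + S g x)"
  unfolding L2_bounded_ops_def by blast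

lemma L2_bounded_ops_scale:
  "S \<in> L2_bounded_ops M \<Longrightarrow> f \<in> L2 M \<Longrightarrow> L2_eq M (S (\<lambda>x. c * f x)) (\<lambda>x. c * S f x)"
  unfolding L2_bounded_ops_def by blast

lemma L2_bounded_ops_diff:
  assumes "S \<in> L2_bounded_ops M" "f \<in> L2 M" "g \<in> L2 M"
  shows "L2_eq M (S (\<lambda>x. f x - g x)) (\<lambda>x. S f x - S g x)"
  using L2_bounded_ops_add[OF assms(1,2) L2_scale[OF assms(3), of "-1"]]
    L2_bounded_ops_scale[OF assms(1,3), of "-1"]
  by (auto simp: L2_eq_def)

lemma L2_bounded_ops_bound:
  assumes "S \<in> L2_bounded_ops M"
  obtains C where "C > 0" "\<And>f. f \<in> L2 M \<Longrightarrow> L2_norm M (S f) \<le> C * L2_norm M f"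
proof -
  obtain C where C: "\<forall>f\<in>L2 M. L2_norm M (S f) \<le> C * L2_norm M f"
    using assms by (auto simp: L2_bounded_ops_def)
  show thesis
  proof (rule that[of "max C 1"])
    show "L2_norm M (S f) \<le> max C 1 * L2_norm M f" if "f \<in> L2 M" for f
      using C that mult_right_mono[of C "max C 1" "L2_norm M f"] by fastforce
  qed simp
qed

lemma L2_bounded_ops_cong:
  assumes S: "S \<in> L2_bounded_ops M" and f: "f \<in> L2 M" and g: "g \<in> L2 M" and eq: "L2_eq M f g"
  shows "L2_eq M (S f) (S g)"
proof -
  note [simp] = L2_bounded_ops_L2[OF S]
  obtain C where C: "\<And>f. f \<in> L2 M \<Longrightarrow> L2_norm M (S f) \<le> C * L2_norm M f"
    using L2_bounded_ops_bound[OF S] by blast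
  have "L2_norm M (\<lambda>x. S f x - S g x) = L2_norm M (S (\<lambda>x. f x - g x))"
    using S f g by (intro L2_norm_cong[OF L2_eq_sym[OF L2_bounded_ops_diff]]) auto
  also have "\<dots> \<le> C * L2_norm M (\<lambda>x. f x - g x)"
    using f g by (intro C) simp
  also have "L2_norm M (\<lambda>x. f x - g x) = 0"
    using eq f g by (simp add: L2_norm_diff_eq_0_iff)
  finally have "L2_norm M (\<lambda>x. S f x - S g x) = 0"
    using L2_norm_nonneg[of M "\<lambda>x. S f x - S g x"] by linarith
  then show ?thesis using S f g by (simp add: L2_norm_diff_eq_0_iff)
qed

lemma L2_bounded_ops_id: "(\<lambda>f. f) \<in> L2_bounded_ops M"
  by (auto simp: L2_bounded_ops_def intro: exI[of _ 1])

lemma L2_bounded_ops_comp: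
  assumes S: "S \<in> L2_bounded_ops M" and T: "T \<in> L2_bounded_ops M"
  shows "(\<lambda>f. S (T f)) \<in> L2_bounded_ops M"
proof -
  note [simp] = L2_bounded_ops_L2[OF S] L2_bounded_ops_L2[OF T]
  obtain C where C: "C > 0" "\<And>f. f \<in> L2 M \<Longrightarrow> L2_norm M (S f) \<le> C * L2_norm M f"
    using L2_bounded_ops_bound[OF S] by blast
  obtain D where D: "\<And>f. f \<in> L2 M \<Longrightarrow> L2_norm M (T f) \<le> D * L2_norm M f"
    using L2_bounded_ops_bound[OF T] by blast
  have "L2_norm M (S (T f)) \<le> C * D * L2_norm M f" if f: "f \<in> L2 M" for f
  proof -
    have "L2_norm M (S (T f)) \<le> C * L2_norm M (T f)" using T f by (intro C) simp
    also have "\<dots> \<le> C * (D * L2_norm M f)" using C(1) D[OF f] by (intro mult_left_mono) auto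
    finally show ?thesis by simp
  qed
  moreover have "L2_eq M (S (T (\<lambda>x. f x + g x))) (\<lambda>x. S (T f) x + S (T g) x)"
    if fg: "f \<in> L2 M" "g \<in> L2 M" for f g
  proof -
    have "L2_eq M (S (T (\<lambda>x. f x + g x))) (S (\<lambda>x. T f x + T g x))"
      using fg by (intro L2_bounded_ops_cong[OF S _ _ L2_bounded_ops_add[OF T]]) auto
    also have "L2_eq M \<dots> (\<lambda>x. S (T f) x + S (T g) x)"
      using fg by (intro L2_bounded_ops_add[OF S]) auto
    finally show ?thesis .
  qed
  moreover have "L2_eq M (S (T (\<lambda>x. c * f x))) (\<lambda>x. c * S (T f) x)" if f: "f \<in> L2 M" for f c
  proof -
    have "L2_eq M (S (T (\<lambda>x. c * f x))) (S (\<lambda>x. c * T f x))"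
      using f by (intro L2_bounded_ops_cong[OF S _ _ L2_bounded_ops_scale[OF T]]) auto
    also have "L2_eq M \<dots> (\<lambda>x. c * S (T f) x)"
      using f by (intro L2_bounded_ops_scale[OF S]) auto
    finally show ?thesis .
  qed
  ultimately show ?thesis
    using S T by (auto simp: L2_bounded_ops_def[of M])
qed

lemma L2_bounded_ops_sum_op:
  assumes S: "S \<in> L2_bounded_ops M" and T: "T \<in> L2_bounded_ops M"
  shows "(\<lambda>f x. S f x + T f x) \<in> L2_bounded_ops M"
proof -
  note [simp] = L2_bounded_ops_L2[OF S] L2_bounded_ops_L2[OF T]
  obtain C where C: "\<And>f. f \<in> L2 M \<Longrightarrow> L2_norm M (S f) \<le> C * L2_norm M f"
    using L2_bounded_ops_bound[OF S] by blast
  obtain D where D: "\<And>f. f \<in> L2 M \<Longrightarrow> L2_norm M (T f) \<le> D * L2_norm M f"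
    using L2_bounded_ops_bound[OF T] by blast
  have "L2_norm M (\<lambda>x. S f x + T f x) \<le> (C + D) * L2_norm M f" if f: "f \<in> L2 M" for f
    using L2_triangle[of "S f" M "T f"] S T f C[OF f] D[OF f] by (simp add: distrib_right)
  moreover have "L2_eq M (\<lambda>x. S (\<lambda>x. f x + g x) x + T (\<lambda>x. f x + g x) x)
      (\<lambda>x. S f x + T f x + (S g x + T g x))" if "f \<in> L2 M" "g \<in> L2 M" for f g
    using L2_bounded_ops_add[OF S that] L2_bounded_ops_add[OF T that] by (auto simp: L2_eq_def)
  moreover have "L2_eq M (\<lambda>x. S (\<lambda>x. c * f x) x + T (\<lambda>x. c * f x) x)
      (\<lambda>x. c * (S f x + T f x))" if "f \<in> L2 M" for f c
    using L2_bounded_ops_scale[OF S that, of c] L2_bounded_ops_scale[OF T that, of c]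
    by (auto simp: L2_eq_def distrib_left)
  ultimately show ?thesis
    using S T by (auto simp: L2_bounded_ops_def[of M])
qed

lemma L2_bounded_ops_scale_op:
  assumes S: "S \<in> L2_bounded_ops M"
  shows "(\<lambda>f x. c * S f x) \<in> L2_bounded_ops M"
proof -
  note [simp] = L2_bounded_ops_L2[OF S]
  obtain C where C: "\<And>f. f \<in> L2 M \<Longrightarrow> L2_norm M (S f) \<le> C * L2_norm M f"
    using L2_bounded_ops_bound[OF S] by blast
  have "L2_norm M (\<lambda>x. c * S f x) \<le> cmod c * C * L2_norm M f" if f: "f \<in> L2 M" for f
    using mult_left_mono[OF C[OF f], of "cmod c"] by (simp add: mult.assoc)
  moreover have "L2_eq M (\<lambda>x. c * S (\<lambda>x. f x + g x) x) (\<lambda>x. c * S f x + c * S g x)"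
    if "f \<in> L2 M" "g \<in> L2 M" for f g
    using L2_bounded_ops_add[OF S that] by (auto simp: L2_eq_def distrib_left)
  moreover have "L2_eq M (\<lambda>x. c * S (\<lambda>x. d * f x) x) (\<lambda>x. d * (c * S f x))"
    if "f \<in> L2 M" for f d
    using L2_bounded_ops_scale[OF S that, of d] by (auto simp: L2_eq_def)
  ultimately show ?thesis
    using S by (auto simp: L2_bounded_ops_def[of M])
qed

lemma L2_bounded_ops_diff_op:
  assumes "S \<in> L2_bounded_ops M" and "T \<in> L2_bounded_ops M"
  shows "(\<lambda>f x. S f x - T f x) \<in> L2_bounded_ops M"
  using L2_bounded_ops_sum_op[OF assms(1) L2_bounded_ops_scale_op[OF assms(2), of "-1"]] by simp

lemma L2_bounded_ops_tensor:
  assumes g: "g \<in> L2 M" and e: "e \<in> L2 M"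
  shows "L2_tensor M g e \<in> L2_bounded_ops M"
proof -
  have "L2_norm M (L2_tensor M g e f) \<le> (L2_norm M e * L2_norm M g) * L2_norm M f"
    if f: "f \<in> L2 M" for f
  proof -
    have "L2_norm M (L2_tensor M g e f) = cmod (L2_inner M f e) * L2_norm M g"
      by (simp add: L2_tensor_def)
    also have "\<dots> \<le> L2_norm M f * L2_norm M e * L2_norm M g"
      by (intro mult_right_mono L2_Cauchy_Schwarz f e) simp
    finally show ?thesis by (simp add: mult_ac)
  qed
  then show ?thesis
    using g e L2_scale[OF g] unfolding L2_bounded_ops_def
    by (auto simp: L2_tensor_def distrib_right mult.assoc intro!: exI[of _ "L2_norm M e * L2_norm M g"])
qed

lemma L2_bounded_ops_funpow: "S \<in> L2_bounded_ops M \<Longrightarrow> S ^^ n \<in> L2_bounded_ops M"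
proof (induction n)
  case 0
  then show ?case using L2_bounded_ops_id[of M] by (simp add: id_def)
next
  case (Suc n)
  then show ?case using L2_bounded_ops_comp[of S M "S ^^ n"] by (simp add: comp_def)
qed

lemma L2_bounded_ops_finite_sum:
  "(\<And>i. i \<in> I \<Longrightarrow> S i \<in> L2_bounded_ops M) \<Longrightarrow> (\<lambda>f x. \<Sum>i\<in>I. S i f x) \<in> L2_bounded_ops M"
proof (induction I rule: infinite_finite_induct)
  case (insert i I)
  then show ?case using L2_bounded_ops_sum_op[of "S i" M "\<lambda>f x. \<Sum>i\<in>I. S i f x"] by simp
qed (use L2_bounded_ops_scale_op[OF L2_bounded_ops_id, of 0] in simp_all)

section \<open>Operator norms, adjoints and norm-convergent series\<close>

lemma L2_onorm_le:
  assumes "\<And>f. f \<in> L2 M \<Longrightarrow> L2_norm M (S f) \<le> B * L2_norm M f" "B \<ge> 0"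
  shows "L2_onorm M S \<le> B"
  unfolding L2_onorm_def
proof (rule cSUP_least)
  show "{f \<in> L2 M. L2_norm M f \<le> 1} \<noteq> {}" using L2_zero[of M] by fastforce
  show "L2_norm M (S f) \<le> B" if "f \<in> {f \<in> L2 M. L2_norm M f \<le> 1}" for f
    using that assms(1)[of f] mult_left_mono[of "L2_norm M f" 1 B] assms(2) by simp
qed

text \<open>A real supremum is informative only over a set that is bounded above; boundedness of
  \<open>S\<close> provides this.\<close>

lemma L2_norm_le_onorm:
  assumes S: "S \<in> L2_bounded_ops M" and f: "f \<in> L2 M" "L2_norm M f \<le> 1"
  shows "L2_norm M (S f) \<le> L2_onorm M S"
proof -
  obtain C where C: "C > 0" "\<And>f. f \<in> L2 M \<Longrightarrow> L2_norm M (S f) \<le> C * L2_norm M f"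
    using L2_bounded_ops_bound[OF S] by blast
  have "L2_norm M (S f) \<le> C" if "f \<in> L2 M" "L2_norm M f \<le> 1" for f
    by (rule order_trans[OF C(2)[OF that(1)]]) (use that(2) C(1) in simp)
  then have "bdd_above ((\<lambda>f. L2_norm M (S f)) ` {f \<in> L2 M. L2_norm M f \<le> 1})"
    by (auto intro!: bdd_aboveI)
  then show ?thesis
    unfolding L2_onorm_def using f by (intro cSUP_upper) simp_all
qed

lemma L2_onorm_bound:
  assumes S: "S \<in> L2_bounded_ops M" and f: "f \<in> L2 M"
  shows "L2_norm M (S f) \<le> L2_onorm M S * L2_norm M f"
proof (cases "L2_norm M f = 0")
  case True
  obtain C where "\<And>f. f \<in> L2 M \<Longrightarrow> L2_norm M (S f) \<le> C * L2_norm M f"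
    using L2_bounded_ops_bound[OF S] by blast
  from this[OF f] True show ?thesis by simp
next
  case False
  then have pos: "L2_norm M f > 0" using L2_norm_nonneg[of M f] by linarith
  define c where "c = complex_of_real (1 / L2_norm M f)"
  have c: "cmod c = 1 / L2_norm M f" using pos by (simp add: c_def norm_divide)
  have "cmod c * L2_norm M (S f) = L2_norm M (S (\<lambda>x. c * f x))"
    using L2_norm_cong[OF L2_bounded_ops_scale[OF S f, of c]] L2_bounded_ops_L2[OF S] f by simp
  also have "\<dots> \<le> L2_onorm M S"
    using f c pos by (intro L2_norm_le_onorm[OF S]) simp_all
  finally show ?thesis using pos c by (simp add: field_simps)
qed

lemma L2_onorm_nonneg:
  assumes "S \<in> L2_bounded_ops M"
  shows "0 \<le> L2_onorm M S"
proof -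
  have "L2_norm M (S (\<lambda>x. 0)) \<le> L2_onorm M S"
    by (rule L2_norm_le_onorm[OF assms]) simp_all
  then show ?thesis using L2_norm_nonneg[of M "S (\<lambda>x. 0)"] by linarith
qed

lemma L2_onorm_cong:
  assumes "S \<in> L2_bounded_ops M" "T \<in> L2_bounded_ops M" "L2_op_eq M S T"
  shows "L2_onorm M S = L2_onorm M T"
  unfolding L2_onorm_def
  using assms by (intro SUP_cong) (auto simp: L2_op_eq_def intro!: L2_norm_cong intro: L2_bounded_ops_L2)

text \<open>Riesz represents \<open>f \<mapsto> L2_inner M (S f) g\<close> by some
  \<open>K g\<close> for each \<open>g\<close> separately. Linearity of \<open>K\<close> then
  follows up to null sets by testing against all vectors.\<close>

lemma L2_adjoint:
  assumes sf: "sigma_finite_measure M" and S: "S \<in> L2_bounded_ops M"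
  shows L2_adjoint_bounded: "L2_adjoint M S \<in> L2_bounded_ops M"
    and L2_adjoint_inner:
      "\<And>f g. f \<in> L2 M \<Longrightarrow> g \<in> L2 M \<Longrightarrow> L2_inner M (S f) g = L2_inner M f (L2_adjoint M S g)"
proof -
  note [simp] = L2_bounded_ops_L2[OF S]
  obtain C where C: "C > 0" "\<And>f. f \<in> L2 M \<Longrightarrow> L2_norm M (S f) \<le> C * L2_norm M f"
    using L2_bounded_ops_bound[OF S] by blast
  have "\<exists>k\<in>L2 M. \<forall>f\<in>L2 M. L2_inner M (S f) g = L2_inner M f k" if g: "g \<in> L2 M" for g
  proof -
    have 1: "L2_inner M (S (\<lambda>x. f x + h x)) g = L2_inner M (S f) g + L2_inner M (S h) g"
      if "f \<in> L2 M" "h \<in> L2 M" for f h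
      using L2_inner_cong[OF L2_bounded_ops_add[OF S that] L2_eq_refl[of M g]] that S g by simp
    have 2: "L2_inner M (S (\<lambda>x. c * f x)) g = c * L2_inner M (S f) g"
      if "f \<in> L2 M" for c f
      using L2_inner_cong[OF L2_bounded_ops_scale[OF S that] L2_eq_refl[of M g]] that S g by simp
    have 3: "cmod (L2_inner M (S f) g) \<le> (C * L2_norm M g) * L2_norm M f" if "f \<in> L2 M" for f
      using L2_Cauchy_Schwarz[of "S f" M g] mult_right_mono[OF C(2)[OF that], of "L2_norm M g"]
        that S g by (simp add: mult_ac)
    show ?thesis
      by (rule L2_Riesz[OF sf, of "\<lambda>f. L2_inner M (S f) g"]) (fact 1 2 3)+
  qed
  then obtain K where K: "\<And>g. g \<in> L2 M \<Longrightarrow> K g \<in> L2 M"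
    and KS: "\<And>f g. f \<in> L2 M \<Longrightarrow> g \<in> L2 M \<Longrightarrow> L2_inner M (S f) g = L2_inner M f (K g)"
    by metis
  have "L2_norm M (K g) \<le> C * L2_norm M g" if g: "g \<in> L2 M" for g
  proof (cases "L2_norm M (K g) = 0")
    case True
    then show ?thesis using C(1) by simp
  next
    case False
    \<comment> \<open>The defining identity at \<open>f = K g\<close>; one factor of the norm of
      \<open>K g\<close> cancels afterwards.\<close>
    have "L2_norm M (K g) * L2_norm M (K g) = cmod (L2_inner M (S (K g)) g)"
      using KS[OF K[OF g] g] by (simp add: L2_inner_self norm_mult norm_power power2_eq_square)
    also have "\<dots> \<le> L2_norm M (S (K g)) * L2_norm M g"
      using S K g by (intro L2_Cauchy_Schwarz) auto
    also have "\<dots> \<le> C * L2_norm M (K g) * L2_norm M g"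
      using C(2)[OF K[OF g]] by (intro mult_right_mono) auto
    finally have "L2_norm M (K g) * L2_norm M (K g) \<le> L2_norm M (K g) * (C * L2_norm M g)"
      by (simp add: mult_ac)
    moreover have "L2_norm M (K g) > 0" using False L2_norm_nonneg[of M "K g"] by linarith
    ultimately show ?thesis by simp
  qed
  moreover have "L2_eq M (K (\<lambda>x. f x + g x)) (\<lambda>x. K f x + K g x)"
    if "f \<in> L2 M" "g \<in> L2 M" for f g
    using that S K by (subst L2_eq_iff_inner) (auto simp: KS[symmetric])
  moreover have "L2_eq M (K (\<lambda>x. c * f x)) (\<lambda>x. c * K f x)" if "f \<in> L2 M" for c f
    using that S K by (subst L2_eq_iff_inner) (auto simp: KS[symmetric])
  ultimately have "K \<in> L2_bounded_ops M"
    using K by (auto simp: L2_bounded_ops_def)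
  with KS have "\<exists>S'. S' \<in> L2_bounded_ops M \<and>
     (\<forall>f\<in>L2 M. \<forall>g\<in>L2 M. L2_inner M (S f) g = L2_inner M f (S' g))" by blast
  from someI_ex[OF this] show "L2_adjoint M S \<in> L2_bounded_ops M"
    and "\<And>f g. f \<in> L2 M \<Longrightarrow> g \<in> L2 M \<Longrightarrow> L2_inner M (S f) g = L2_inner M f (L2_adjoint M S g)"
    unfolding L2_adjoint_def by blast+
qed

lemma L2_adjoint_eqI:
  assumes sf: "sigma_finite_measure M" and S: "S \<in> L2_bounded_ops M"
    and g: "g \<in> L2 M" and k: "k \<in> L2 M"
    and eq: "\<And>f. f \<in> L2 M \<Longrightarrow> L2_inner M (S f) g = L2_inner M f k"
  shows "L2_eq M (L2_adjoint M S g) k"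
  using L2_adjoint_inner[OF sf S _ g] eq
  by (subst L2_eq_iff_inner[OF L2_bounded_ops_L2[OF L2_adjoint_bounded[OF sf S] g] k]) auto

text \<open>Norm limits are unique, because two limits differ by at most the sum of their errors. So
  any explicit limit may stand in for the chosen one.\<close>

lemma L2_op_suminf_eqI:
  assumes B: "\<And>n. B n \<in> L2_bounded_ops M" and A: "A \<in> L2_bounded_ops M"
    and lim: "(\<lambda>N. L2_onorm M (\<lambda>f x. (\<Sum>n<N. B n f x) - A f x)) \<longlonglongrightarrow> 0"
  shows "L2_op_suminf M B \<in> L2_bounded_ops M" "L2_op_eq M (L2_op_suminf M B) A"
proof -
  define A' where "A' = L2_op_suminf M B"
  have "A' \<in> L2_bounded_ops M \<and> (\<lambda>N. L2_onorm M (\<lambda>f x. (\<Sum>n<N. B n f x) - A' f x)) \<longlonglongrightarrow> 0"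
    unfolding A'_def L2_op_suminf_def by (rule someI[of _ A]) (use A lim in blast)
  then have A': "A' \<in> L2_bounded_ops M"
    and lim': "(\<lambda>N. L2_onorm M (\<lambda>f x. (\<Sum>n<N. B n f x) - A' f x)) \<longlonglongrightarrow> 0" by auto
  have "L2_eq M (A' f) (A f)" if f: "f \<in> L2 M" for f
  proof -
    let ?D = "\<lambda>A N. (\<lambda>f x. (\<Sum>n<N. B n f x) - A f x)"
    note mem = L2_bounded_ops_diff_op[OF L2_bounded_ops_finite_sum[OF B]]
    have "L2_norm M (\<lambda>x. A' f x - A f x) \<le> L2_onorm M (?D A N) * L2_norm M f + L2_onorm M (?D A' N) * L2_norm M f"
      for N
    proof -
      have "L2_norm M (\<lambda>x. A' f x - A f x) = L2_norm M (\<lambda>x. ?D A N f x - ?D A' N f x)"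
        by simp
      also have "\<dots> \<le> L2_norm M (?D A N f) + L2_norm M (?D A' N f)"
        by (rule L2_triangle_diff[OF L2_bounded_ops_L2[OF mem[OF A] f] L2_bounded_ops_L2[OF mem[OF A'] f]])
      also have "\<dots> \<le> L2_onorm M (?D A N) * L2_norm M f + L2_onorm M (?D A' N) * L2_norm M f"
        by (rule add_mono[OF L2_onorm_bound[OF mem[OF A] f] L2_onorm_bound[OF mem[OF A'] f]])
      finally show ?thesis .
    qed
    moreover have "(\<lambda>N. L2_onorm M (?D A N) * L2_norm M f + L2_onorm M (?D A' N) * L2_norm M f)
        \<longlonglongrightarrow> 0 * L2_norm M f + 0 * L2_norm M f"
      by (rule tendsto_add[OF tendsto_mult[OF lim tendsto_const] tendsto_mult[OF lim' tendsto_const]])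
    ultimately have "L2_norm M (\<lambda>x. A' f x - A f x) \<le> 0 * L2_norm M f + 0 * L2_norm M f"
      by (intro LIMSEQ_le_const) auto
    then have "L2_norm M (\<lambda>x. A' f x - A f x) = 0"
      using L2_norm_nonneg[of M "\<lambda>x. A' f x - A f x"] by linarith
    then show ?thesis
      by (subst (asm) L2_norm_diff_eq_0_iff[OF L2_bounded_ops_L2[OF A' f] L2_bounded_ops_L2[OF A f]])
  qed
  then show "L2_op_suminf M B \<in> L2_bounded_ops M" "L2_op_eq M (L2_op_suminf M B) A"
    using A' by (auto simp: A'_def L2_op_eq_def)
qed

text \<open>
  With \<open>v = R h - b h\<close> one has \<open>R v = -b v\<close>, so positivity of \<open>R\<close> forces \<open>v = 0\<close>. This gives the
  uniqueness of the positive square root of an operator that is diagonalized by eigenvectors.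
\<close>

lemma L2_positive_sqrt_eigenvector:
  assumes R: "L2_positive M R" and h: "h \<in> L2 M" and b: "b > 0"
    and RR: "L2_eq M (R (R h)) (\<lambda>x. (complex_of_real b)\<^sup>2 * h x)"
  shows "L2_eq M (R h) (\<lambda>x. complex_of_real b * h x)"
proof -
  have Rops: "R \<in> L2_bounded_ops M" using R by (simp add: L2_positive_def)
  note [simp] = L2_bounded_ops_L2[OF Rops] h
  let ?b = "complex_of_real b"
  let ?v = "\<lambda>x. R h x - ?b * h x"
  have v: "?v \<in> L2 M" by simp
  have "L2_eq M (R ?v) (\<lambda>x. R (R h) x - R (\<lambda>x. ?b * h x) x)"
    by (intro L2_bounded_ops_diff[OF Rops]) auto
  moreover have "L2_eq M (R (\<lambda>x. ?b * h x)) (\<lambda>x. ?b * R h x)"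
    by (intro L2_bounded_ops_scale[OF Rops]) auto
  ultimately have "L2_eq M (R ?v) (\<lambda>x. - ?b * ?v x)"
    using RR by (auto simp: L2_eq_def algebra_simps power2_eq_square)
  then have "L2_inner M (R ?v) ?v = L2_inner M (\<lambda>x. - ?b * ?v x) ?v"
    by (rule L2_inner_cong[OF _ L2_eq_refl L2_bounded_ops_L2[OF Rops v] L2_scale[OF v] v v])
  also have "\<dots> = - ?b * complex_of_real ((L2_norm M ?v)\<^sup>2)"
    by (simp only: L2_inner_scale_left L2_inner_self)
  finally have "L2_inner M (R ?v) ?v = complex_of_real (- b * (L2_norm M ?v)\<^sup>2)"
    by (simp only: of_real_mult of_real_minus)
  moreover have "0 \<le> Re (L2_inner M (R ?v) ?v)"
    using R v unfolding L2_positive_def by blast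
  ultimately have "b * (L2_norm M ?v)\<^sup>2 \<le> 0" by simp
  then have "(L2_norm M ?v)\<^sup>2 \<le> 0"
    using b mult_le_0_iff by force
  then have "L2_norm M ?v = 0" by simp
  then show ?thesis by (subst (asm) L2_norm_diff_eq_0_iff) auto
qed

section \<open>Rank-one perturbations of the identity\<close>

text \<open>This is \<open>I + c (e tensor e)\<close>. It fixes the vectors orthogonal to
  \<open>e\<close> and multiplies \<open>e\<close> by one plus \<open>c\<close> times the squared
  norm of \<open>e\<close>. The parameter is real because all members that occur are
  self-adjoint.\<close>

definition L2_shift :: "'a measure \<Rightarrow> ('a \<Rightarrow> complex) \<Rightarrow> real \<Rightarrow> 'a L2_map" where
  "L2_shift M e c = (\<lambda>f x. f x + complex_of_real c * L2_inner M f e * e x)"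

lemma L2_shift_bounded_ops:
  assumes "e \<in> L2 M"
  shows "L2_shift M e c \<in> L2_bounded_ops M"
  using L2_bounded_ops_sum_op[OF L2_bounded_ops_id
      L2_bounded_ops_scale_op[OF L2_bounded_ops_tensor[OF assms assms], of "complex_of_real c"]]
  by (simp add: L2_shift_def L2_tensor_def mult.assoc)

lemma L2_shift_L2[simp]: "e \<in> L2 M \<Longrightarrow> f \<in> L2 M \<Longrightarrow> L2_shift M e c f \<in> L2 M"
  by (simp add: L2_shift_def)

lemma L2_shift_0[simp]: "L2_shift M e 0 f = f"
  by (simp add: L2_shift_def)

lemma L2_inner_shift_left:
  "e \<in> L2 M \<Longrightarrow> f \<in> L2 M \<Longrightarrow> h \<in> L2 M \<Longrightarrow>
    L2_inner M (L2_shift M e c f) h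
      = L2_inner M f h + complex_of_real c * L2_inner M f e * L2_inner M e h"
  by (simp add: L2_shift_def)

lemma L2_inner_shift_same:
  "e \<in> L2 M \<Longrightarrow> f \<in> L2 M \<Longrightarrow>
    L2_inner M (L2_shift M e c f) e = complex_of_real (1 + c * (L2_norm M e)\<^sup>2) * L2_inner M f e"
  by (simp add: L2_inner_shift_left L2_inner_self algebra_simps)

text \<open>Writing \<open>N\<close> for the squared norm of \<open>e\<close>, the new parameter is
  read off from the product of eigenvalues \<open>(1 + c * N) * (1 + d * N)\<close>.\<close>

lemma L2_shift_shift:
  assumes "e \<in> L2 M" "f \<in> L2 M"
  shows "L2_shift M e c (L2_shift M e d f) = L2_shift M e (c + d + c * d * (L2_norm M e)\<^sup>2) f"
proof
  fix x
  have "L2_shift M e c (L2_shift M e d f) x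
      = L2_shift M e d f x + complex_of_real c * L2_inner M (L2_shift M e d f) e * e x"
    by (simp only: L2_shift_def[of M e c])
  then show "L2_shift M e c (L2_shift M e d f) x
      = L2_shift M e (c + d + c * d * (L2_norm M e)\<^sup>2) f x"
    unfolding L2_inner_shift_same[OF assms] by (simp add: L2_shift_def algebra_simps)
qed

lemma L2_shift_positive:
  assumes e: "e \<in> L2 M" and c: "c \<ge> 0"
  shows "L2_positive M (L2_shift M e c)"
  unfolding L2_positive_def
proof (intro conjI ballI L2_shift_bounded_ops e)
  fix f assume f: "f \<in> L2 M"
  have "complex_of_real c * L2_inner M f e * L2_inner M e f
      = complex_of_real (c * (cmod (L2_inner M f e))\<^sup>2)"
    using L2_inner_commute[of M e f]
    by (simp only: of_real_mult complex_norm_square mult.assoc)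
  then have "L2_inner M (L2_shift M e c f) f
      = complex_of_real ((L2_norm M f)\<^sup>2 + c * (cmod (L2_inner M f e))\<^sup>2)"
    using e f by (simp only: L2_inner_shift_left L2_inner_self of_real_add)
  then show "L2_inner M (L2_shift M e c f) f \<in> \<real>" "0 \<le> Re (L2_inner M (L2_shift M e c f) f)"
    using c by (simp_all only: Reals_of_real Re_complex_of_real) simp
qed

text \<open>The parameter of \<open>A\<close> is the one that \<open>L2_shift_shift\<close> gives
  for \<open>d = c\<close>. Uniqueness of the positive root comes from applying
  \<open>L2_positive_sqrt_eigenvector\<close> to \<open>e\<close> and to the part of a vector
  orthogonal to \<open>e\<close>, with eigenvalues \<open>1 + c * N\<close> and 1.\<close>

lemma L2_op_sqrt_shift:
  assumes e: "e \<in> L2 M" and pos: "L2_norm M e > 0" and c: "c \<ge> 0"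
    and A: "L2_op_eq M A (L2_shift M e (2 * c + c\<^sup>2 * (L2_norm M e)\<^sup>2))"
  shows "L2_op_sqrt M A \<in> L2_bounded_ops M" "L2_op_eq M (L2_op_sqrt M A) (L2_shift M e c)"
proof -
  define N where "N = (L2_norm M e)\<^sup>2"
  define R where "R = L2_op_sqrt M A"
  have N: "N > 0" using pos by (simp add: N_def)
  have ee: "L2_inner M e e = complex_of_real N" by (simp add: N_def L2_inner_self)
  have Af: "L2_eq M (A f) (L2_shift M e (2 * c + c\<^sup>2 * N) f)" if "f \<in> L2 M" for f
    using A that by (simp add: L2_op_eq_def N_def)
  have "L2_op_eq M (L2_shift M e c \<circ> L2_shift M e c) A"
    unfolding L2_op_eq_def
  proof
    fix f assume f: "f \<in> L2 M"
    have "(L2_shift M e c \<circ> L2_shift M e c) f = L2_shift M e (2 * c + c\<^sup>2 * N) f"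
      by (simp add: L2_shift_shift[OF e f] N_def power2_eq_square)
    then show "L2_eq M ((L2_shift M e c \<circ> L2_shift M e c) f) (A f)"
      using L2_eq_sym[OF Af[OF f]] by simp
  qed
  with L2_shift_positive[OF e c] have "L2_positive M R \<and> L2_op_eq M (R \<circ> R) A"
    unfolding R_def L2_op_sqrt_def
    by (intro someI[where P = "\<lambda>R. L2_positive M R \<and> L2_op_eq M (R \<circ> R) A" and x = "L2_shift M e c"])
      simp
  then have R: "L2_positive M R" and RR: "L2_op_eq M (R \<circ> R) A" by auto
  have Rops: "R \<in> L2_bounded_ops M" using R by (simp add: L2_positive_def)
  have RRf: "L2_eq M (R (R f)) (L2_shift M e (2 * c + c\<^sup>2 * N) f)" if "f \<in> L2 M" for f
  proof -
    have "L2_eq M (R (R f)) (A f)" using RR that by (simp add: L2_op_eq_def)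
    then show ?thesis using Af[OF that] by (rule L2_eq_trans)
  qed
  have "L2_shift M e (2 * c + c\<^sup>2 * N) e = (\<lambda>x. (complex_of_real (1 + c * N))\<^sup>2 * e x)"
    by (simp add: L2_shift_def ee algebra_simps power2_eq_square)
  then have Re: "L2_eq M (R e) (\<lambda>x. complex_of_real (1 + c * N) * e x)"
    using RRf[OF e] N c by (intro L2_positive_sqrt_eigenvector[OF R e]) (auto intro: add_pos_nonneg)
  have "L2_eq M (R f) (L2_shift M e c f)" if f: "f \<in> L2 M" for f
  proof -
    \<comment> \<open>The coefficient of the projection to \<open>e\<close>, so that
      \<open>h\<close> below is orthogonal to \<open>e\<close>.\<close>
    define z where "z = L2_inner M f e / complex_of_real N"
    define h where "h = (\<lambda>x. f x - z * e x)"
    have h: "h \<in> L2 M" using e f by (simp add: h_def)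
    have "L2_inner M h e = L2_inner M f e - z * complex_of_real N"
      using e f by (simp add: h_def ee)
    then have he: "L2_inner M h e = 0"
      using N by (simp add: z_def)
    have "L2_eq M (R h) (\<lambda>x. complex_of_real 1 * h x)"
      using RRf[OF h] he by (intro L2_positive_sqrt_eigenvector[OF R h]) (auto simp: L2_shift_def)
    moreover have "L2_eq M (R (\<lambda>x. h x + z * e x)) (\<lambda>x. R h x + R (\<lambda>x. z * e x) x)"
      using h e by (intro L2_bounded_ops_add[OF Rops]) auto
    moreover have "L2_eq M (R (\<lambda>x. z * e x)) (\<lambda>x. z * R e x)"
      by (rule L2_bounded_ops_scale[OF Rops e])
    ultimately have "L2_eq M (R (\<lambda>x. h x + z * e x)) (\<lambda>x. h x + z * (complex_of_real (1 + c * N) * e x))"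
      using Re by (auto simp: L2_eq_def)
    moreover have "(\<lambda>x. h x + z * e x) = f" by (simp add: h_def)
    moreover have "(\<lambda>x. h x + z * (complex_of_real (1 + c * N) * e x)) = L2_shift M e c f"
      using N by (auto simp: h_def z_def L2_shift_def field_simps)
    ultimately show ?thesis by simp
  qed
  then show "L2_op_sqrt M A \<in> L2_bounded_ops M" "L2_op_eq M (L2_op_sqrt M A) (L2_shift M e c)"
    using Rops by (auto simp: R_def L2_op_eq_def)
qed

text \<open>The parameter \<open>d\<close> solves \<open>1 + d * N = 1 / (1 + c * N)\<close> for
  \<open>N\<close> the squared norm of \<open>e\<close>, which makes the composite parameter in
  \<open>L2_shift_shift\<close> vanish.\<close>

lemma L2_inverse_shift:
  assumes e: "e \<in> L2 M" and R: "R \<in> L2_bounded_ops M" and Rc: "L2_op_eq M R (L2_shift M e c)"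
    and nz: "1 + c * (L2_norm M e)\<^sup>2 \<noteq> 0"
  defines "d \<equiv> - c / (1 + c * (L2_norm M e)\<^sup>2)"
  shows "L2_inverse M R \<in> L2_bounded_ops M" "L2_op_eq M (L2_inverse M R) (L2_shift M e d)"
proof -
  have cd: "c + d + c * d * (L2_norm M e)\<^sup>2 = 0" "d + c + d * c * (L2_norm M e)\<^sup>2 = 0"
    using nz unfolding d_def by (simp_all add: field_simps)
  note D = L2_shift_bounded_ops[OF e, of d]
  have RD: "L2_eq M (R (L2_shift M e d f)) f" if f: "f \<in> L2 M" for f
  proof -
    have "L2_eq M (R (L2_shift M e d f)) (L2_shift M e c (L2_shift M e d f))"
      using Rc f e by (simp add: L2_op_eq_def)
    then show ?thesis unfolding L2_shift_shift[OF e f] cd by simp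
  qed
  have DR: "L2_eq M (L2_shift M e d (R f)) f" if f: "f \<in> L2 M" for f
  proof -
    have "L2_eq M (L2_shift M e d (R f)) (L2_shift M e d (L2_shift M e c f))"
      using Rc f e by (intro L2_bounded_ops_cong[OF D] L2_bounded_ops_L2[OF R]) (auto simp: L2_op_eq_def)
    then show ?thesis unfolding L2_shift_shift[OF e f] cd by simp
  qed
  have "L2_is_inverse M R (L2_shift M e d)"
    using D RD DR by (simp add: L2_is_inverse_def L2_op_eq_def)
  then have inv: "L2_is_inverse M R (L2_inverse M R)"
    unfolding L2_inverse_def by (rule someI[where P = "L2_is_inverse M R"])
  then show I: "L2_inverse M R \<in> L2_bounded_ops M" by (simp add: L2_is_inverse_def)
  have "L2_eq M (L2_inverse M R f) (L2_shift M e d f)" if f: "f \<in> L2 M" for f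
  proof -
    have Df: "L2_shift M e d f \<in> L2 M" using e f by simp
    have "L2_eq M (L2_inverse M R f) (L2_inverse M R (R (L2_shift M e d f)))"
      by (intro L2_bounded_ops_cong[OF I f L2_bounded_ops_L2[OF R Df]] L2_eq_sym[OF RD[OF f]])
    also have "L2_eq M \<dots> (L2_shift M e d f)"
      using inv Df by (simp add: L2_is_inverse_def L2_op_eq_def)
    finally show ?thesis .
  qed
  then show "L2_op_eq M (L2_inverse M R) (L2_shift M e d)" by (simp add: L2_op_eq_def)
qed

section \<open>Rank-one operators\<close>

text \<open>Each application after the first contributes one factor \<open>L2_inner M g e\<close>.
  The power 0 is the identity and does not fit the pattern, hence \<open>Suc n\<close>. The lemma
  serves both \<open>T\<close> and its adjoint, where \<open>g\<close> and \<open>e\<close> change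
  places.\<close>

lemma L2_rank_one_funpow:
  assumes T: "T \<in> L2_bounded_ops M" and g: "g \<in> L2 M"
    and eq: "\<And>f. f \<in> L2 M \<Longrightarrow> L2_eq M (T f) (\<lambda>x. L2_inner M f e * g x)" and f: "f \<in> L2 M"
  shows "L2_eq M ((T ^^ Suc n) f) (\<lambda>x. L2_inner M g e ^ n * L2_inner M f e * g x)"
proof (induction n)
  case 0
  then show ?case using eq[OF f] by simp
next
  case (Suc n)
  have "L2_eq M (T ((T ^^ Suc n) f)) (T (\<lambda>x. L2_inner M g e ^ n * L2_inner M f e * g x))"
    by (intro L2_bounded_ops_cong[OF T] L2_bounded_ops_L2[OF L2_bounded_ops_funpow[OF T]] L2_scale f g Suc)
  also have "L2_eq M \<dots> (\<lambda>x. L2_inner M (\<lambda>x. L2_inner M g e ^ n * L2_inner M f e * g x) e * g x)"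
    by (intro eq L2_scale g)
  also have "L2_inner M (\<lambda>x. L2_inner M g e ^ n * L2_inner M f e * g x) e
      = L2_inner M g e ^ Suc n * L2_inner M f e"
    unfolding L2_inner_scale_left by simp
  finally show ?case by simp
qed

text \<open>\<open>T\<close> is required to be the tensor of \<open>g\<close> and \<open>e\<close>
  only up to null sets, which fits a given operator as well as \<open>L2_tensor M g e\<close>
  itself. Both kinds of instance occur in the theorem.\<close>

locale L2_rank_one =
  fixes M :: "'a measure" and g e :: "'a \<Rightarrow> complex" and T :: "'a L2_map"
  assumes sf: "sigma_finite_measure M"
    and g: "g \<in> L2 M" and e: "e \<in> L2 M"
    and g_pos: "L2_norm M g > 0" and e_pos: "L2_norm M e > 0"
    and T: "T \<in> L2_bounded_ops M"
    and T_eq: "f \<in> L2 M \<Longrightarrow> L2_eq M (T f) (\<lambda>x. L2_inner M f e * g x)"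
begin

abbreviation "r \<equiv> cmod (L2_inner M g e)"
abbreviation "N \<equiv> (L2_norm M e)\<^sup>2"
abbreviation "d m \<equiv> 1 / (1 / real m + r)"

lemma N_pos: "N > 0"
  using e_pos by simp

lemma inner_e_e: "L2_inner M e e = complex_of_real N"
  by (rule L2_inner_self)

section \<open>Powers, adjoint and spectrum of a rank-one operator\<close>

lemma funpow_Suc:
  "f \<in> L2 M \<Longrightarrow> L2_eq M ((T ^^ Suc n) f) (\<lambda>x. L2_inner M g e ^ n * L2_inner M f e * g x)"
  by (rule L2_rank_one_funpow[OF T g T_eq])

lemma adjoint_eq:
  assumes h: "h \<in> L2 M"
  shows "L2_eq M (L2_adjoint M T h) (\<lambda>x. L2_inner M h g * e x)"
proof (rule L2_adjoint_eqI[OF sf T h L2_scale[OF e]])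
  fix f assume f: "f \<in> L2 M"
  have "L2_inner M (T f) h = L2_inner M (\<lambda>x. L2_inner M f e * g x) h"
    by (rule L2_inner_cong[OF T_eq[OF f] L2_eq_refl L2_bounded_ops_L2[OF T f] L2_scale[OF g] h h])
  then show "L2_inner M (T f) h = L2_inner M f (\<lambda>x. L2_inner M h g * e x)"
    using L2_inner_commute[of M g h] by simp
qed

text \<open>The powers of \<open>L2_inner M g e\<close> from \<open>T\<close> meet their conjugates
  from the adjoint, giving \<open>r ^ (2 * n)\<close>; the remaining factor is the inner product of
  \<open>g\<close> with itself.\<close>

lemma adjoint_funpow_funpow:
  assumes f: "f \<in> L2 M"
  shows "L2_eq M ((L2_adjoint M T ^^ Suc n) ((T ^^ Suc n) f))
    (\<lambda>x. complex_of_real (r ^ (2 * n) * (L2_norm M g)\<^sup>2) * L2_inner M f e * e x)"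
proof -
  let ?l = "L2_inner M g e"
  note A = L2_adjoint_bounded[OF sf T]
  note Tf = L2_bounded_ops_L2[OF L2_bounded_ops_funpow[OF T, of "Suc n"] f]
  have "L2_eq M ((L2_adjoint M T ^^ Suc n) ((T ^^ Suc n) f))
      (\<lambda>x. L2_inner M e g ^ n * L2_inner M ((T ^^ Suc n) f) g * e x)"
    by (rule L2_rank_one_funpow[OF A e adjoint_eq Tf])
  also have "L2_inner M ((T ^^ Suc n) f) g = L2_inner M (\<lambda>x. ?l ^ n * L2_inner M f e * g x) g"
    by (rule L2_inner_cong[OF funpow_Suc[OF f] L2_eq_refl Tf L2_scale[OF g] g g])
  also have "L2_inner M e g ^ n * \<dots> = (cnj ?l * ?l) ^ n * complex_of_real ((L2_norm M g)\<^sup>2) * L2_inner M f e"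
    unfolding L2_inner_scale_left L2_inner_self L2_inner_commute[of M e g] power_mult_distrib
    by (simp only: mult_ac)
  also have "cnj ?l * ?l = complex_of_real (r\<^sup>2)"
    by (simp only: complex_norm_square mult.commute)
  finally show ?thesis
    by (simp add: power_mult)
qed

text \<open>With \<open>l = L2_inner M g e\<close> one has \<open>T\<^sup>2 = l T\<close>, so an
  inverse can be sought as \<open>- 1 / z + a T\<close>. Comparing the coefficients of
  \<open>T\<close> forces \<open>a = 1 / (z * (l - z))\<close>.\<close>

lemma resolvent:
  assumes z: "z \<noteq> 0" "z \<noteq> L2_inner M g e"
  shows "\<exists>S'. L2_is_inverse M (\<lambda>f x. T f x - z * f x) S'"
proof -
  let ?l = "L2_inner M g e"
  let ?a = "1 / (z * (?l - z))"
  define S where "S = (\<lambda>f x. (- 1 / z) * f x + ?a * T f x)"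
  have S: "S \<in> L2_bounded_ops M"
    unfolding S_def
    by (intro L2_bounded_ops_sum_op L2_bounded_ops_scale_op L2_bounded_ops_id T)
  have TT: "L2_eq M (T (T f)) (\<lambda>x. ?l * T f x)" if f: "f \<in> L2 M" for f
    using funpow_Suc[OF f, of 1] T_eq[OF f] by (auto simp: L2_eq_def mult_ac)
  have a: "?a * (?l * y - z * y) = y / z" for y
    using z by (simp add: left_diff_distrib[symmetric])
  have alg: "(- 1 / z) * (y - z * v) + ?a * (?l * y - z * y) = v" for y v
    unfolding a using z by (simp add: field_simps)
  \<comment> \<open>Both orders of composition are the same polynomial in \<open>T\<close>, so the
    computation for the left inverse also gives the right inverse.\<close>
  have expand: "((- 1 / z) * y + a * (?l * y)) - z * ((- 1 / z) * v + a * y)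
      = (- 1 / z) * (y - z * v) + a * (?l * y - z * y)" for a y v
    using z(1) by (simp add: algebra_simps)
  have alg': "((- 1 / z) * y + ?a * (?l * y)) - z * ((- 1 / z) * v + ?a * y) = v" for y v
  proof -
    have "((- 1 / z) * y + ?a * (?l * y)) - z * ((- 1 / z) * v + ?a * y)
        = (- 1 / z) * (y - z * v) + ?a * (?l * y - z * y)"
      by (rule expand)
    then show ?thesis by (simp only: alg)
  qed
  have "L2_eq M (S (\<lambda>x. T f x - z * f x)) f" if f: "f \<in> L2 M" for f
  proof -
    note Tf = L2_bounded_ops_L2[OF T f]
    from L2_bounded_ops_diff[OF T Tf L2_scale[OF f, of z]] L2_bounded_ops_scale[OF T f, of z] TT[OF f]
    have "L2_eq M (T (\<lambda>x. T f x - z * f x)) (\<lambda>x. ?l * T f x - z * T f x)"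
      by (auto simp: L2_eq_def)
    then show ?thesis unfolding S_def L2_eq_def
    proof eventually_elim
      case (elim x)
      show ?case unfolding elim by (rule alg)
    qed
  qed
  moreover have "L2_eq M (\<lambda>x. T (S f) x - z * S f x) f" if f: "f \<in> L2 M" for f
  proof -
    note Tf = L2_bounded_ops_L2[OF T f]
    from L2_bounded_ops_add[OF T L2_scale[OF f, of "- 1 / z"] L2_scale[OF Tf, of ?a]]
      L2_bounded_ops_scale[OF T f, of "- 1 / z"] L2_bounded_ops_scale[OF T Tf, of ?a] TT[OF f]
    have "L2_eq M (T (S f)) (\<lambda>x. (- 1 / z) * T f x + ?a * (?l * T f x))"
      unfolding S_def L2_eq_def by eventually_elim simp
    then show ?thesis unfolding L2_eq_def
    proof eventually_elim
      case (elim x)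
      show ?case unfolding elim unfolding S_def by (rule alg')
    qed
  qed
  ultimately have "L2_is_inverse M (\<lambda>f x. T f x - z * f x) S"
    using S by (simp add: L2_is_inverse_def L2_op_eq_def)
  then show ?thesis by (rule exI[of _ S])
qed

text \<open>\<open>g\<close> is an eigenvector for \<open>L2_inner M g e\<close>. Whether 0 is in
  the spectrum depends on the dimension, but it cannot change the supremum of the moduli.\<close>

lemma spectral_radius: "L2_spectral_radius M T = r"
proof -
  let ?l = "L2_inner M g e"
  have "z = 0 \<or> z = ?l" if "z \<in> L2_spectrum M T" for z
    using resolvent[of z] that by (auto simp: L2_spectrum_def)
  moreover have "?l \<in> L2_spectrum M T"
    unfolding L2_spectrum_def mem_Collect_eq
  proof
    assume "\<exists>S'. L2_is_inverse M (\<lambda>f x. T f x - ?l * f x) S'"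
    then obtain S where S: "S \<in> L2_bounded_ops M"
      and inv: "\<And>f. f \<in> L2 M \<Longrightarrow> L2_eq M (S (\<lambda>x. T f x - ?l * f x)) f"
      by (auto simp: L2_is_inverse_def L2_op_eq_def)
    have "L2_eq M (\<lambda>x. T g x - ?l * g x) (\<lambda>x. 0 * g x)"
      using T_eq[OF g] by (auto simp: L2_eq_def)
    then have "L2_eq M (S (\<lambda>x. T g x - ?l * g x)) (S (\<lambda>x. 0 * g x))"
      using L2_bounded_ops_L2[OF T g] g by (intro L2_bounded_ops_cong[OF S]) simp_all
    also have "L2_eq M \<dots> (\<lambda>x. 0 * S g x)"
      by (rule L2_bounded_ops_scale[OF S g])
    finally have "L2_eq M g (\<lambda>x. 0)"
      using L2_eq_trans[OF L2_eq_sym[OF inv[OF g]]] by simp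
    then show False using g g_pos by (simp add: L2_norm_eq_0_iff[symmetric])
  qed
  ultimately show ?thesis
    unfolding L2_spectral_radius_def by (intro cSup_eq_maximum) fastforce+
qed

section \<open>The series, its square root and the parameters involved\<close>

lemma sra_d_eq: "L2_sra_d M T m = d m"
  by (simp add: L2_sra_d_def spectral_radius)

text \<open>The closed form of the geometric series with terms \<open>b m\<close>, whose ratio is
  \<open>(d m * r)\<^sup>2\<close>.\<close>

definition t :: "nat \<Rightarrow> real" where
  "t m = (L2_norm M g)\<^sup>2 * (d m)\<^sup>2 / (1 - (d m * r)\<^sup>2)"

text \<open>The nonnegative solution of \<open>2 * c + c\<^sup>2 * N = t m\<close>, so the root of
  the shift by \<open>t m\<close> is the shift by \<open>c m\<close>.\<close>

definition c :: "nat \<Rightarrow> real" where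
  "c m = (sqrt (1 + t m * N) - 1) / N"

text \<open>The coefficient of \<open>e tensor e\<close> in the summand with index \<open>n\<close>.
  It is 0 at \<open>n = 0\<close>, where the summand is the identity that \<open>L2_shift\<close>
  already contains.\<close>

definition b :: "nat \<Rightarrow> nat \<Rightarrow> real" where
  "b m n = (case n of 0 \<Rightarrow> 0 | Suc k \<Rightarrow> d m ^ (2 * Suc k) * (r ^ (2 * k) * (L2_norm M g)\<^sup>2))"

text \<open>The offset \<open>1 / real m\<close> makes the bound strict and the series convergent.
  In HOL it is 0 for \<open>m = 0\<close>, where the bound would fail as soon as \<open>r\<close> is
  positive.\<close>

lemma dr_bounds:
  assumes "m \<ge> 1"
  shows "0 \<le> d m * r" "d m * r < 1"
proof -
  have "1 / real m + r > 0" using assms by (intro add_pos_nonneg) auto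
  then show "0 \<le> d m * r" "d m * r < 1"
    using assms by (auto simp: divide_less_eq)
qed

lemma t_nonneg:
  assumes "m \<ge> 1"
  shows "t m \<ge> 0"
proof -
  have "(d m * r)\<^sup>2 < 1" using dr_bounds[OF assms] by (simp add: power_less_one_iff abs_square_less_1)
  then show ?thesis unfolding t_def by (intro divide_nonneg_pos) auto
qed

lemma b_sums:
  assumes m: "m \<ge> 1"
  shows "b m sums t m"
proof -
  have "(d m * r)\<^sup>2 < 1" using dr_bounds[OF m] by (simp add: abs_square_less_1)
  then have "(\<lambda>k. ((d m * r)\<^sup>2) ^ k) sums (1 / (1 - (d m * r)\<^sup>2))"
    by (intro geometric_sums) simp
  from sums_mult[OF this, of "(L2_norm M g)\<^sup>2 * (d m)\<^sup>2"]
  have "(\<lambda>k. (L2_norm M g)\<^sup>2 * (d m)\<^sup>2 * ((d m * r)\<^sup>2) ^ k) sums t m"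
    by (simp add: t_def)
  moreover have "(L2_norm M g)\<^sup>2 * (d m)\<^sup>2 * ((d m * r)\<^sup>2) ^ k = b m (Suc k)" for k
  proof -
    have "((d m * r)\<^sup>2) ^ k = d m ^ (2 * k) * r ^ (2 * k)"
      by (simp only: power_mult power_mult_distrib)
    moreover have "d m ^ (2 * Suc k) = (d m)\<^sup>2 * d m ^ (2 * k)"
      by (simp only: mult_Suc_right power_add)
    ultimately show ?thesis by (simp only: b_def nat.case mult_ac)
  qed
  ultimately have "(\<lambda>k. b m (Suc k)) sums t m" by simp
  then show ?thesis using sums_Suc[of "b m" "t m"] by (simp add: b_def)
qed

text \<open>The unboundedness of \<open>t m\<close> comes from \<open>(1/m + r)\<^sup>2 - r\<^sup>2 \<rightarrow> 0\<close>.\<close>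

lemma t_ge:
  assumes m: "m \<ge> 1"
  shows "t m \<ge> (L2_norm M g)\<^sup>2 / (1 + 2 * r) * real m"
proof -
  define s where "s = 1 / real m + r"
  have s: "s > 0" "s > r" using m unfolding s_def by (auto intro: add_pos_nonneg)
  have "s\<^sup>2 - r\<^sup>2 = (1 / real m) * (1 / real m + 2 * r)"
    unfolding s_def by (simp add: power2_eq_square algebra_simps)
  also have "\<dots> \<le> (1 / real m) * (1 + 2 * r)"
    using m by (intro mult_left_mono) auto
  finally have le: "s\<^sup>2 - r\<^sup>2 \<le> (1 + 2 * r) / real m" by simp
  have pos: "s\<^sup>2 - r\<^sup>2 > 0"
    using s by (simp add: power_strict_mono)
  have "1 - (1 / s * r)\<^sup>2 = (s\<^sup>2 - r\<^sup>2) / s\<^sup>2"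
    using s by (simp add: power_divide diff_divide_distrib)
  then have "t m = (L2_norm M g)\<^sup>2 * (1 / s)\<^sup>2 / ((s\<^sup>2 - r\<^sup>2) / s\<^sup>2)"
    by (simp only: t_def s_def[symmetric])
  also have "\<dots> = (L2_norm M g)\<^sup>2 / (s\<^sup>2 - r\<^sup>2)"
    using s by (simp add: power_divide)
  also have "\<dots> \<ge> (L2_norm M g)\<^sup>2 / ((1 + 2 * r) / real m)"
    using le pos by (intro divide_left_mono mult_pos_pos) auto
  finally show ?thesis by simp
qed

lemma c_nonneg: "m \<ge> 1 \<Longrightarrow> c m \<ge> 0"
  using t_nonneg[of m] N_pos unfolding c_def by (intro divide_nonneg_pos) auto

lemma one_plus_cN: "1 + c m * N = sqrt (1 + t m * N)"
  using N_pos by (simp add: c_def)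

lemma t_eq_c:
  assumes "m \<ge> 1"
  shows "t m = 2 * c m + (c m)\<^sup>2 * N"
proof -
  have "(1 + c m * N)\<^sup>2 = 1 + t m * N"
    unfolding one_plus_cN using t_nonneg[OF assms] by simp
  then have "N * (2 * c m + (c m)\<^sup>2 * N) = N * t m"
    by (simp add: power2_eq_square algebra_simps)
  then show ?thesis using N_pos by (simp only: mult_cancel_left) auto
qed

text \<open>The range \<open>Suc k\<close> ensures that the summand \<open>n = 0\<close>, the
  identity, is present; the empty sum is not of the form \<open>L2_shift\<close>.\<close>

lemma partial_sums:
  assumes m: "m \<ge> 1" and f: "f \<in> L2 M"
  shows "L2_eq M (\<lambda>x. \<Sum>n<Suc k. complex_of_real (d m ^ (2 * n)) * (L2_adjoint M T ^^ n) ((T ^^ n) f) x)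
    (L2_shift M e (\<Sum>n<Suc k. b m n) f)"
proof (induction k)
  case 0
  then show ?case by (simp add: b_def)
next
  case (Suc k)
  have "L2_eq M (\<lambda>x. complex_of_real (d m ^ (2 * Suc k)) * (L2_adjoint M T ^^ Suc k) ((T ^^ Suc k) f) x)
      (\<lambda>x. complex_of_real (b m (Suc k)) * L2_inner M f e * e x)"
    using L2_eq_scale[OF adjoint_funpow_funpow[OF f, of k], of "complex_of_real (d m ^ (2 * Suc k))"]
    by (simp only: b_def nat.case of_real_mult mult.assoc)
  from L2_eq_add[OF Suc this]
  have "L2_eq M (\<lambda>x. \<Sum>n<Suc (Suc k). complex_of_real (d m ^ (2 * n)) * (L2_adjoint M T ^^ n) ((T ^^ n) f) x)
    (\<lambda>x. L2_shift M e (\<Sum>n<Suc k. b m n) f x + complex_of_real (b m (Suc k)) * L2_inner M f e * e x)"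
    by (simp only: sum.lessThan_Suc)
  also have "(\<lambda>x. L2_shift M e (\<Sum>n<Suc k. b m n) f x + complex_of_real (b m (Suc k)) * L2_inner M f e * e x)
      = L2_shift M e (\<Sum>n<Suc (Suc k). b m n) f"
    by (simp add: L2_shift_def algebra_simps)
  finally show ?case .
qed

text \<open>Each error operator is a multiple of \<open>e tensor e\<close>, so its norm is at most
  \<open>N\<close> times the error of the scalar series.\<close>

lemma suminf_eq:
  assumes m: "m \<ge> 1"
  defines "B \<equiv> \<lambda>n f x. complex_of_real (d m ^ (2 * n)) * (L2_adjoint M T ^^ n) ((T ^^ n) f) x"
  shows "L2_op_eq M (L2_op_suminf M B) (L2_shift M e (t m))"
proof (rule L2_op_suminf_eqI)
  note A = L2_adjoint_bounded[OF sf T]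
  show B: "B n \<in> L2_bounded_ops M" for n
    unfolding B_def
    by (rule L2_bounded_ops_scale_op[OF L2_bounded_ops_comp[OF
          L2_bounded_ops_funpow[OF A] L2_bounded_ops_funpow[OF T]]])
  show shift: "L2_shift M e (t m) \<in> L2_bounded_ops M"
    by (rule L2_shift_bounded_ops[OF e])
  show "(\<lambda>k. L2_onorm M (\<lambda>f x. (\<Sum>n<k. B n f x) - L2_shift M e (t m) f x)) \<longlonglongrightarrow> 0"
  proof (rule LIMSEQ_imp_Suc, rule Lim_null_comparison)
    have "L2_onorm M (\<lambda>f x. (\<Sum>n<Suc k. B n f x) - L2_shift M e (t m) f x)
        \<le> \<bar>(\<Sum>n<Suc k. b m n) - t m\<bar> * N" for k
    proof (rule L2_onorm_le)
      fix f assume f: "f \<in> L2 M"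
      let ?s = "(\<Sum>n<Suc k. b m n) - t m"
      have "L2_eq M (\<lambda>x. (\<Sum>n<Suc k. B n f x) - L2_shift M e (t m) f x)
          (\<lambda>x. L2_shift M e (\<Sum>n<Suc k. b m n) f x - L2_shift M e (t m) f x)"
        unfolding B_def by (rule L2_eq_diff[OF partial_sums[OF m f] L2_eq_refl])
      also have "(\<lambda>x. L2_shift M e (\<Sum>n<Suc k. b m n) f x - L2_shift M e (t m) f x)
          = (\<lambda>x. complex_of_real ?s * L2_inner M f e * e x)"
        by (simp add: L2_shift_def algebra_simps)
      finally have "L2_norm M (\<lambda>x. (\<Sum>n<Suc k. B n f x) - L2_shift M e (t m) f x)
          = L2_norm M (\<lambda>x. complex_of_real ?s * L2_inner M f e * e x)"
        by (rule L2_norm_cong[OF _ L2_diff[OF L2_sum[OF L2_bounded_ops_L2[OF B f]]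
                L2_bounded_ops_L2[OF shift f]] L2_scale[OF e]])
      also have "\<dots> = \<bar>?s\<bar> * (cmod (L2_inner M f e) * L2_norm M e)"
        by (simp only: L2_norm_scale norm_mult norm_of_real mult.assoc)
      also have "\<dots> \<le> \<bar>?s\<bar> * (L2_norm M f * L2_norm M e * L2_norm M e)"
        by (intro mult_left_mono mult_right_mono L2_Cauchy_Schwarz f e) auto
      finally show "L2_norm M (\<lambda>x. (\<Sum>n<Suc k. B n f x) - L2_shift M e (t m) f x)
          \<le> \<bar>?s\<bar> * N * L2_norm M f"
        by (simp only: power2_eq_square mult_ac)
    qed (use N_pos in simp)
    moreover have "0 \<le> L2_onorm M (\<lambda>f x. (\<Sum>n<Suc k. B n f x) - L2_shift M e (t m) f x)" for k
      by (rule L2_onorm_nonneg[OF L2_bounded_ops_diff_op[OF L2_bounded_ops_finite_sum[OF B] shift]])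
    ultimately show "\<forall>\<^sub>F k in sequentially. norm (L2_onorm M (\<lambda>f x. (\<Sum>n<Suc k. B n f x) - L2_shift M e (t m) f x))
        \<le> \<bar>(\<Sum>n<Suc k. b m n) - t m\<bar> * N"
      by (simp only: real_norm_def abs_of_nonneg eventually_True)
    have "(\<lambda>k. (\<Sum>n<Suc k. b m n)) \<longlonglongrightarrow> t m"
      using b_sums[OF m] unfolding sums_def by (rule LIMSEQ_Suc)
    then have "(\<lambda>k. \<bar>(\<Sum>n<Suc k. b m n) - t m\<bar> * N) \<longlonglongrightarrow> \<bar>t m - t m\<bar> * N"
      by (intro tendsto_intros)
    then show "(\<lambda>k. \<bar>(\<Sum>n<Suc k. b m n) - t m\<bar> * N) \<longlonglongrightarrow> 0"
      by simp
  qed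
qed

lemma sra_R:
  assumes m: "m \<ge> 1"
  shows "L2_sra_R M T m \<in> L2_bounded_ops M" "L2_op_eq M (L2_sra_R M T m) (L2_shift M e (c m))"
  using L2_op_sqrt_shift[OF e e_pos c_nonneg[OF m] suminf_eq[OF m, unfolded t_eq_c[OF m]]]
  unfolding L2_sra_R_def sra_d_eq by auto

abbreviation "c' m \<equiv> - c m / (1 + c m * N)"

lemma one_plus_cN_ge: "m \<ge> 1 \<Longrightarrow> 1 + c m * N \<ge> 1"
  using c_nonneg N_pos by simp

text \<open>The operator norm sees only classes modulo null sets, so the chosen root and inverse may
  be replaced by explicit shifts.\<close>

lemma sra_onorm:
  assumes m: "m \<ge> 1" and S: "S \<in> L2_bounded_ops M"
  shows "L2_onorm M (L2_sra_R M T m \<circ> S \<circ> L2_inverse M (L2_sra_R M T m))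
    = L2_onorm M (\<lambda>f. L2_shift M e (c m) (S (L2_shift M e (c' m) f)))"
proof -
  note R = sra_R[OF m]
  have "1 + c m * N \<noteq> 0" using one_plus_cN_ge[OF m] by simp
  note I = L2_inverse_shift[OF e R this]
  note C = L2_shift_bounded_ops[OF e, of "c m"] and C' = L2_shift_bounded_ops[OF e, of "c' m"]
  have "L2_eq M (L2_sra_R M T m (S (L2_inverse M (L2_sra_R M T m) f)))
      (L2_shift M e (c m) (S (L2_shift M e (c' m) f)))" if f: "f \<in> L2 M" for f
  proof -
    note If = L2_bounded_ops_L2[OF I(1) f] and C'f = L2_bounded_ops_L2[OF C' f]
    note SIf = L2_bounded_ops_L2[OF S If]
    have "L2_eq M (L2_sra_R M T m (S (L2_inverse M (L2_sra_R M T m) f)))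
        (L2_shift M e (c m) (S (L2_inverse M (L2_sra_R M T m) f)))"
      using R(2) SIf by (simp add: L2_op_eq_def)
    also have "L2_eq M (S (L2_inverse M (L2_sra_R M T m) f)) (S (L2_shift M e (c' m) f))"
      using I(2) f by (intro L2_bounded_ops_cong[OF S If C'f]) (simp add: L2_op_eq_def)
    then have "L2_eq M (L2_shift M e (c m) (S (L2_inverse M (L2_sra_R M T m) f)))
        (L2_shift M e (c m) (S (L2_shift M e (c' m) f)))"
      by (rule L2_bounded_ops_cong[OF C SIf L2_bounded_ops_L2[OF S C'f]])
    finally show ?thesis .
  qed
  then show ?thesis
    unfolding comp_def L2_op_eq_def[symmetric]
    by (intro L2_onorm_cong[OF L2_bounded_ops_comp[OF R(1) L2_bounded_ops_comp[OF S I(1)]]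
          L2_bounded_ops_comp[OF C L2_bounded_ops_comp[OF S C']]]) (simp add: L2_op_eq_def)
qed

section \<open>Bounded conjugation and eigenvectors of the adjoint\<close>

lemma eigenvector_iff:
  assumes S: "S \<in> L2_bounded_ops M"
  shows "L2_eigenvector M (L2_adjoint M S) e \<longleftrightarrow> (\<exists>z. L2_eq M (L2_adjoint M S e) (\<lambda>x. z * e x))"
  using e e_pos by (auto simp: L2_eigenvector_def L2_norm_eq_0_iff[symmetric])

text \<open>Let \<open>h\<close> be the part of the adjoint image \<open>k\<close> of
  \<open>e\<close> that is orthogonal to \<open>e\<close>. Its squared norm equals the inner product
  of \<open>h\<close> with \<open>k\<close>, that is, of \<open>S h\<close> with \<open>e\<close>,
  and so is 0.\<close>

lemma eigenvectorI:
  assumes S: "S \<in> L2_bounded_ops M"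
    and orth: "\<And>h. h \<in> L2 M \<Longrightarrow> L2_inner M h e = 0 \<Longrightarrow> L2_inner M (S h) e = 0"
  shows "L2_eigenvector M (L2_adjoint M S) e"
proof -
  define k where "k = L2_adjoint M S e"
  have k: "k \<in> L2 M"
    unfolding k_def by (rule L2_bounded_ops_L2[OF L2_adjoint_bounded[OF sf S] e])
  define z where "z = L2_inner M k e / complex_of_real N"
  define h where "h = (\<lambda>x. k x - z * e x)"
  have h: "h \<in> L2 M" using k e by (simp add: h_def)
  have "L2_inner M h e = L2_inner M k e - z * complex_of_real N"
    using k e by (simp add: h_def inner_e_e)
  then have he: "L2_inner M h e = 0" using N_pos by (simp add: z_def)
  have "L2_inner M h k = 0"
    using orth[OF h he] L2_adjoint_inner[OF sf S h e] by (simp add: k_def)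
  moreover have "L2_inner M h h = L2_inner M h k - cnj z * L2_inner M h e"
    by (subst (2) h_def, subst L2_inner_diff_right[OF k L2_scale[OF e] h]) simp
  ultimately have "L2_norm M h = 0" using he by (simp add: L2_inner_self)
  then have "L2_eq M k (\<lambda>x. z * e x)"
    unfolding h_def by (simp add: L2_norm_diff_eq_0_iff[OF k L2_scale[OF e]])
  then show ?thesis unfolding eigenvector_iff[OF S] k_def by blast
qed

text \<open>The growth of \<open>c m\<close> is cancelled: the \<open>e\<close>-component of the
  inner shift carries \<open>1 / (1 + c m * N)\<close>, and the eigenvector equation passes this
  factor on to the \<open>e\<close>-component of its image under \<open>S\<close>. The triangle
  inequality gives the inner shift norm at most 2, whence \<open>2 * C\<close>.\<close>

lemma eigenvector_bound:
  assumes S: "S \<in> L2_bounded_ops M" and z: "L2_eq M (L2_adjoint M S e) (\<lambda>x. z * e x)"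
    and C: "C > 0" "\<And>f. f \<in> L2 M \<Longrightarrow> L2_norm M (S f) \<le> C * L2_norm M f"
    and m: "m \<ge> 1"
  shows "L2_onorm M (\<lambda>f. L2_shift M e (c m) (S (L2_shift M e (c' m) f))) \<le> 2 * C + cmod z"
proof (rule L2_onorm_le)
  fix f assume f: "f \<in> L2 M"
  define a where "a = 1 + c m * N"
  define k where "k = L2_shift M e (c' m) f"
  have a: "a \<ge> 1" unfolding a_def by (rule one_plus_cN_ge[OF m])
  have "c m / a * N = (a - 1) / a" by (simp add: a_def)
  also have "\<dots> \<le> 1" using a by (simp add: divide_le_eq)
  finally have ca: "0 \<le> c m / a" "c m / a * N \<le> 1"
    using a c_nonneg[OF m] by simp_all
  have k: "k \<in> L2 M" using e f by (simp add: k_def)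
  have fe: "cmod (L2_inner M f e) * L2_norm M e \<le> L2_norm M f * N"
    using mult_right_mono[OF L2_Cauchy_Schwarz[OF f e], of "L2_norm M e"]
    by (simp add: power2_eq_square mult.assoc)
  have shrink: "c m / a * (cmod (L2_inner M f e) * L2_norm M e) \<le> L2_norm M f"
  proof -
    have "c m / a * (cmod (L2_inner M f e) * L2_norm M e) \<le> c m / a * (L2_norm M f * N)"
      by (rule mult_left_mono[OF fe ca(1)])
    also have "\<dots> = (c m / a * N) * L2_norm M f" by simp
    also have "\<dots> \<le> 1 * L2_norm M f" by (rule mult_right_mono[OF ca(2)]) simp
    finally show ?thesis by simp
  qed
  have "L2_norm M k \<le> L2_norm M f + L2_norm M (\<lambda>x. complex_of_real (c' m) * L2_inner M f e * e x)"
    unfolding k_def L2_shift_def by (intro L2_triangle L2_scale e f)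
  also have "L2_norm M (\<lambda>x. complex_of_real (c' m) * L2_inner M f e * e x)
      = c m / a * (cmod (L2_inner M f e) * L2_norm M e)"
    using ca(1) by (simp only: L2_norm_scale norm_mult norm_of_real mult.assoc a_def[symmetric]
        minus_divide_left[symmetric] abs_minus_cancel abs_of_nonneg)
  finally have knorm: "L2_norm M k \<le> 2 * L2_norm M f" using shrink by linarith
  have "1 + c' m * N = 1 / a" using a by (simp add: a_def field_simps)
  then have ke: "L2_inner M k e = complex_of_real (1 / a) * L2_inner M f e"
    unfolding k_def L2_inner_shift_same[OF e f] by simp
  have Ske: "L2_inner M (S k) e = cnj z * (complex_of_real (1 / a) * L2_inner M f e)"
    using L2_adjoint_inner[OF sf S k e]
      L2_inner_cong[OF L2_eq_refl z k k L2_bounded_ops_L2[OF L2_adjoint_bounded[OF sf S] e] L2_scale[OF e]]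
    by (simp add: ke)
  have "L2_norm M (L2_shift M e (c m) (S k))
      \<le> L2_norm M (S k) + L2_norm M (\<lambda>x. complex_of_real (c m) * L2_inner M (S k) e * e x)"
    unfolding L2_shift_def by (intro L2_triangle L2_scale e L2_bounded_ops_L2[OF S k])
  also have "L2_norm M (\<lambda>x. complex_of_real (c m) * L2_inner M (S k) e * e x)
      = cmod z * (c m / a * (cmod (L2_inner M f e) * L2_norm M e))"
    unfolding Ske L2_norm_scale using c_nonneg[OF m] a by (simp add: norm_mult norm_divide)
  also have "\<dots> \<le> cmod z * L2_norm M f"
    by (rule mult_left_mono[OF shrink]) simp
  also have "L2_norm M (S k) \<le> C * (2 * L2_norm M f)"
    using C(2)[OF k] mult_left_mono[OF knorm, of C] C(1) by linarith
  finally show "L2_norm M (L2_shift M e (c m) (S (L2_shift M e (c' m) f))) \<le> (2 * C + cmod z) * L2_norm M f"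
    by (simp add: k_def algebra_simps)
qed (use C(1) in simp)

text \<open>The inner shift fixes \<open>h\<close>, so the outer one multiplies the
  \<open>e\<close>-component of \<open>S h\<close> by the full factor
  \<open>sqrt (1 + t m * N)\<close>. This is unbounded in \<open>m\<close> by \<open>t_ge\<close>,
  while the product stays below a constant.\<close>

lemma orthogonal_if_bounded:
  assumes S: "S \<in> L2_bounded_ops M"
    and K: "\<And>m. m \<ge> 1 \<Longrightarrow> L2_onorm M (\<lambda>f. L2_shift M e (c m) (S (L2_shift M e (c' m) f))) \<le> K"
    and h: "h \<in> L2 M" and he: "L2_inner M h e = 0"
  shows "L2_inner M (S h) e = 0"
proof (rule ccontr)
  define q where "q = cmod (L2_inner M (S h) e)"
  define B where "B = K * L2_norm M h * L2_norm M e"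
  define \<kappa> where "\<kappa> = (L2_norm M g)\<^sup>2 / (1 + 2 * r) * N"
  assume "L2_inner M (S h) e \<noteq> 0"
  then have q: "q > 0" by (simp add: q_def)
  have \<kappa>: "\<kappa> > 0" unfolding \<kappa>_def
    using g_pos N_pos by (intro mult_pos_pos divide_pos_pos) (auto intro: add_pos_nonneg)
  have le: "sqrt (1 + t m * N) * q \<le> B" if m: "m \<ge> 1" for m
  proof -
    note Sh = L2_bounded_ops_L2[OF S h]
    note ops = L2_bounded_ops_comp[OF L2_shift_bounded_ops[OF e]
        L2_bounded_ops_comp[OF S L2_shift_bounded_ops[OF e]]]
    have hh: "L2_shift M e (c' m) h = h" by (simp add: L2_shift_def he)
    have "sqrt (1 + t m * N) * q = cmod (L2_inner M (L2_shift M e (c m) (S h)) e)"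
      unfolding L2_inner_shift_same[OF e Sh] one_plus_cN q_def
      using t_nonneg[OF m] by (simp add: norm_mult)
    also have "\<dots> \<le> L2_norm M (L2_shift M e (c m) (S h)) * L2_norm M e"
      by (intro L2_Cauchy_Schwarz L2_shift_L2 e Sh)
    also have "\<dots> \<le> (K * L2_norm M h) * L2_norm M e"
    proof (rule mult_right_mono)
      have "L2_norm M (L2_shift M e (c m) (S h))
          \<le> L2_onorm M (\<lambda>f. L2_shift M e (c m) (S (L2_shift M e (c' m) f))) * L2_norm M h"
        using L2_onorm_bound[OF ops h, of "c m" "c' m"] unfolding hh .
      also have "\<dots> \<le> K * L2_norm M h" by (rule mult_right_mono[OF K[OF m]]) simp
      finally show "L2_norm M (L2_shift M e (c m) (S h)) \<le> K * L2_norm M h" .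
    qed simp
    finally show ?thesis by (simp add: B_def)
  qed
  \<comment> \<open>\<open>\<kappa>\<close> is the slope of the linear lower bound for
    \<open>t m * N\<close>; this \<open>n\<close> pushes \<open>sqrt (1 + t m * N)\<close> beyond
    \<open>B / q\<close>.\<close>
  obtain n where n: "(B / q)\<^sup>2 / \<kappa> < real n" using reals_Archimedean2 by blast
  define m where "m = max n 1"
  have m: "m \<ge> 1" by (simp add: m_def)
  have "(B / q)\<^sup>2 < \<kappa> * real n"
    using n \<kappa> by (simp add: divide_less_eq mult.commute)
  also have "\<dots> \<le> \<kappa> * real m" using \<kappa> by (simp add: m_def)
  also have "\<dots> = (L2_norm M g)\<^sup>2 / (1 + 2 * r) * real m * N" by (simp add: \<kappa>_def)
  also have "\<dots> \<le> t m * N" using t_ge[OF m] by (rule mult_right_mono) simp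
  finally have "(B / q)\<^sup>2 < 1 + t m * N" by simp
  then have "B / q < sqrt (1 + t m * N)" by (rule real_less_rsqrt)
  then have "B < sqrt (1 + t m * N) * q" using q by (simp add: divide_less_eq)
  with le[OF m] show False by simp
qed

lemma spectral_radius_algebra_eq:
  "L2_spectral_radius_algebra M T = {S \<in> L2_bounded_ops M. L2_eigenvector M (L2_adjoint M S) e}"
proof -
  have "bdd_above ((\<lambda>m. L2_onorm M (L2_sra_R M T m \<circ> S \<circ> L2_inverse M (L2_sra_R M T m))) ` {1..})
      \<longleftrightarrow> L2_eigenvector M (L2_adjoint M S) e" if S: "S \<in> L2_bounded_ops M" for S
  proof
    assume "bdd_above ((\<lambda>m. L2_onorm M (L2_sra_R M T m \<circ> S \<circ> L2_inverse M (L2_sra_R M T m))) ` {1..})"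
    then obtain K where K: "\<And>m. m \<ge> 1 \<Longrightarrow>
        L2_onorm M (L2_sra_R M T m \<circ> S \<circ> L2_inverse M (L2_sra_R M T m)) \<le> K"
      by (auto simp: bdd_above_def)
    have "L2_onorm M (\<lambda>f. L2_shift M e (c m) (S (L2_shift M e (c' m) f))) \<le> K" if "m \<ge> 1" for m
      using K[OF that] unfolding sra_onorm[OF that S] .
    then show "L2_eigenvector M (L2_adjoint M S) e"
      by (intro eigenvectorI[OF S] orthogonal_if_bounded[OF S]) auto
  next
    assume "L2_eigenvector M (L2_adjoint M S) e"
    then obtain z where z: "L2_eq M (L2_adjoint M S e) (\<lambda>x. z * e x)"
      unfolding eigenvector_iff[OF S] by blast
    obtain C where C: "C > 0" "\<And>f. f \<in> L2 M \<Longrightarrow> L2_norm M (S f) \<le> C * L2_norm M f"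
      using L2_bounded_ops_bound[OF S] by blast
    show "bdd_above ((\<lambda>m. L2_onorm M (L2_sra_R M T m \<circ> S \<circ> L2_inverse M (L2_sra_R M T m))) ` {1..})"
    proof (rule bdd_aboveI2)
      fix m :: nat assume "m \<in> {1..}"
      then have m: "m \<ge> 1" by simp
      show "L2_onorm M (L2_sra_R M T m \<circ> S \<circ> L2_inverse M (L2_sra_R M T m)) \<le> 2 * C + cmod z"
        unfolding sra_onorm[OF m S] by (rule eigenvector_bound[OF S z C m])
    qed
  qed
  then show ?thesis by (simp add: L2_spectral_radius_algebra_def cong: conj_cong)
qed

text \<open>For \<open>n = Suc k\<close> both norms carry the common factor
  \<open>r ^ k * L2_norm M g\<close>. So \<open>n = 1\<close> implies all larger cases, even if
  \<open>r = 0\<close>, and \<open>n = 0\<close> is just boundedness of \<open>S\<close>.\<close>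

lemma Deddens_algebra_iff:
  assumes S: "S \<in> L2_bounded_ops M"
  shows "S \<in> L2_Deddens_algebra M T \<longleftrightarrow>
    (\<exists>C>0. \<forall>h\<in>L2 M. cmod (L2_inner M h (L2_adjoint M S e)) \<le> C * cmod (L2_inner M h e))"
proof -
  have norm: "L2_norm M ((T ^^ Suc n) f) = r ^ n * (cmod (L2_inner M f e) * L2_norm M g)"
    if f: "f \<in> L2 M" for f n
    using L2_norm_cong[OF funpow_Suc[OF f, of n] L2_bounded_ops_L2[OF L2_bounded_ops_funpow[OF T] f] L2_scale[OF g]]
    by (simp only: L2_norm_scale norm_mult norm_power mult.assoc)
  have adj: "L2_inner M h (L2_adjoint M S e) = L2_inner M (S h) e" if "h \<in> L2 M" for h
    by (rule L2_adjoint_inner[OF sf S that e, symmetric])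
  show ?thesis
  proof
    assume "S \<in> L2_Deddens_algebra M T"
    then obtain C where C: "C > 0"
      and le: "\<And>n f. f \<in> L2 M \<Longrightarrow> L2_norm M ((T ^^ n) (S f)) \<le> C * L2_norm M ((T ^^ n) f)"
      by (auto simp: L2_Deddens_algebra_def)
    have "cmod (L2_inner M h (L2_adjoint M S e)) \<le> C * cmod (L2_inner M h e)" if h: "h \<in> L2 M" for h
    proof -
      have "cmod (L2_inner M (S h) e) * L2_norm M g \<le> (C * cmod (L2_inner M h e)) * L2_norm M g"
        using le[OF h, of "Suc 0"]
        unfolding norm[OF h] norm[OF L2_bounded_ops_L2[OF S h]] by (simp add: mult.assoc)
      then show ?thesis unfolding adj[OF h] using g_pos by (rule mult_right_le_imp_le)
    qed
    with C show "\<exists>C>0. \<forall>h\<in>L2 M. cmod (L2_inner M h (L2_adjoint M S e)) \<le> C * cmod (L2_inner M h e)"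
      by blast
  next
    assume "\<exists>C>0. \<forall>h\<in>L2 M. cmod (L2_inner M h (L2_adjoint M S e)) \<le> C * cmod (L2_inner M h e)"
    then obtain C where C: "C > 0"
      and le: "\<And>h. h \<in> L2 M \<Longrightarrow> cmod (L2_inner M h (L2_adjoint M S e)) \<le> C * cmod (L2_inner M h e)"
      by blast
    obtain D where D: "D > 0" "\<And>f. f \<in> L2 M \<Longrightarrow> L2_norm M (S f) \<le> D * L2_norm M f"
      using L2_bounded_ops_bound[OF S] by blast
    \<comment> \<open>One constant for all \<open>n\<close>: \<open>D\<close> covers
      \<open>n = 0\<close> and \<open>C\<close> covers the rest.\<close>
    have "L2_norm M ((T ^^ n) (S f)) \<le> (C + D) * L2_norm M ((T ^^ n) f)" if f: "f \<in> L2 M" for n f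
    proof (cases n)
      case 0
      have "D * L2_norm M f \<le> (C + D) * L2_norm M f"
        using C by (intro mult_right_mono) auto
      with 0 D(2)[OF f] show ?thesis by simp
    next
      case (Suc k)
      have "cmod (L2_inner M (S f) e) \<le> C * cmod (L2_inner M f e)"
        using le[OF f] unfolding adj[OF f] .
      also have "\<dots> \<le> (C + D) * cmod (L2_inner M f e)"
        using D(1) by (intro mult_right_mono) auto
      finally have "r ^ k * (cmod (L2_inner M (S f) e) * L2_norm M g)
          \<le> r ^ k * (((C + D) * cmod (L2_inner M f e)) * L2_norm M g)"
        by (intro mult_left_mono mult_right_mono) auto
      then show ?thesis
        unfolding Suc norm[OF f] norm[OF L2_bounded_ops_L2[OF S f]] by (simp only: mult_ac)
    qed
    moreover have "C + D > 0" using C D(1) by simp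
    ultimately show "S \<in> L2_Deddens_algebra M T"
      using S unfolding L2_Deddens_algebra_def by blast
  qed
qed

end

text \<open>The norm of \<open>g\<close> cancels, so the relation is the same for every nonzero
  \<open>g\<close>. This is why a single witness suffices in (ii).\<close>

lemma L2_majorizes_tensor_iff:
  assumes "L2_norm M g > 0"
  shows "L2_majorizes M (L2_tensor M g e) (L2_tensor M g k) \<longleftrightarrow>
    (\<exists>C>0. \<forall>h\<in>L2 M. cmod (L2_inner M h k) \<le> C * cmod (L2_inner M h e))"
proof -
  have "cmod (L2_inner M h k) * L2_norm M g \<le> C * (cmod (L2_inner M h e) * L2_norm M g)
      \<longleftrightarrow> cmod (L2_inner M h k) \<le> C * cmod (L2_inner M h e)" for h C
    using assms by (simp add: mult.assoc[symmetric])
  then show ?thesis by (simp add: L2_majorizes_def L2_tensor_def)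
qed

lemma L2_rank_one_tensor:
  assumes "sigma_finite_measure M" "g \<in> L2 M" "e \<in> L2 M" "L2_norm M g > 0" "L2_norm M e > 0"
  shows "L2_rank_one M g e (L2_tensor M g e)"
  by (rule L2_rank_one.intro[OF assms L2_bounded_ops_tensor[OF assms(2,3)]]) (simp add: L2_tensor_def)

text \<open>An operator majorized by \<open>f \<otimes> e\<close> vanishes on the complement of \<open>e\<close>.\<close>

lemma L2_rank_one_if_majorized:
  assumes sf: "sigma_finite_measure M" and f: "f \<in> L2 M" and e: "e \<in> L2 M"
    and T: "T \<in> L2_bounded_ops M" and nz: "\<not> L2_op_eq M T (\<lambda>f x. 0)"
    and maj: "L2_majorizes M (L2_tensor M f e) T"
  shows "L2_norm M f > 0" "L2_norm M e > 0" "\<exists>g. L2_rank_one M g e T"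
proof -
  obtain C where C: "\<And>h. h \<in> L2 M \<Longrightarrow> L2_norm M (T h) \<le> C * (cmod (L2_inner M h e) * L2_norm M f)"
    using maj by (auto simp: L2_majorizes_def L2_tensor_def)
  obtain h where h: "h \<in> L2 M" and Th: "\<not> L2_eq M (T h) (\<lambda>x. 0)"
    using nz by (auto simp: L2_op_eq_def)
  have Th_pos: "L2_norm M (T h) > 0"
    using Th L2_norm_eq_0_iff[OF L2_bounded_ops_L2[OF T h]] L2_norm_nonneg[of M "T h"] by linarith
  have "L2_norm M f \<noteq> 0" using C[OF h] Th_pos by auto
  then show "L2_norm M f > 0" using L2_norm_nonneg[of M f] by linarith
  have "L2_norm M e \<noteq> 0"
    using C[OF h] Th_pos L2_Cauchy_Schwarz[OF h e] by auto
  then show e_pos: "L2_norm M e > 0" using L2_norm_nonneg[of M e] by linarith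
  define N where "N = complex_of_real ((L2_norm M e)\<^sup>2)"
  have N: "N \<noteq> 0" using e_pos by (simp add: N_def)
  \<comment> \<open>Forced by evaluating the desired equation at \<open>e\<close>, where the inner
    product is \<open>N\<close>.\<close>
  define g where "g = (\<lambda>x. 1 / N * T e x)"
  have g: "g \<in> L2 M" unfolding g_def by (intro L2_scale L2_bounded_ops_L2[OF T e])
  have eq: "L2_eq M (T k) (\<lambda>x. L2_inner M k e * g x)" if k: "k \<in> L2 M" for k
  proof -
    define z where "z = L2_inner M k e / N"
    define p where "p = (\<lambda>x. k x - z * e x)"
    have p: "p \<in> L2 M" using k e by (simp add: p_def)
    have "L2_inner M p e = L2_inner M k e - z * N"
      using k e by (simp add: p_def L2_inner_self N_def)
    then have "L2_inner M p e = 0" using N by (simp add: z_def)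
    then have "L2_norm M (T p) = 0"
      using C[OF p] L2_norm_nonneg[of M "T p"] by simp
    then have "L2_eq M (T p) (\<lambda>x. 0)"
      by (subst (asm) L2_norm_eq_0_iff[OF L2_bounded_ops_L2[OF T p]])
    moreover have "L2_eq M (T p) (\<lambda>x. T k x - T (\<lambda>x. z * e x) x)"
      unfolding p_def by (rule L2_bounded_ops_diff[OF T k L2_scale[OF e]])
    moreover have "L2_eq M (T (\<lambda>x. z * e x)) (\<lambda>x. z * T e x)"
      by (rule L2_bounded_ops_scale[OF T e])
    ultimately have "L2_eq M (T k) (\<lambda>x. z * T e x)"
      by (auto simp: L2_eq_def)
    then show ?thesis by (simp add: g_def z_def)
  qed
  have "L2_norm M g \<noteq> 0"
  proof
    assume "L2_norm M g = 0"
    moreover have "L2_norm M (T h) = cmod (L2_inner M h e) * L2_norm M g"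
      using L2_norm_cong[OF eq[OF h] L2_bounded_ops_L2[OF T h] L2_scale[OF g]] by simp
    ultimately show False using Th_pos by simp
  qed
  then have "L2_norm M g > 0" using L2_norm_nonneg[of M g] by linarith
  then have "L2_rank_one M g e T"
    by (intro L2_rank_one.intro sf g e e_pos T eq)
  then show "\<exists>g. L2_rank_one M g e T" by (rule exI[of _ g])
qed

text \<open>Two degenerate cases are excluded. Every rank-one operator majorizes
  \<open>T = 0\<close>, whose Deddens and spectral radius algebras contain all bounded operators.
  And \<open>g = 0\<close> would make (ii) true for every \<open>S\<close>.\<close>

theorem theorem3p12:
  fixes M F :: "'a measure"
    and f1 f2 u w :: "'a \<Rightarrow> complex"
    and T :: "('a \<Rightarrow> complex) \<Rightarrow> ('a \<Rightarrow> complex)"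
  assumes "complete_measure M" and "sigma_finite_measure M"
    and "sigma_finite_subalgebra M F"
    and "f1 \<in> L2 M" and "f2 \<in> L2 M"
    and "wct_admissible M F w u"
    and "T = wct_op M F w u" and "T \<in> L2_bounded_ops M"
    and "\<not> L2_op_eq M T (\<lambda>f x. 0)"
    and "L2_majorizes M (L2_tensor M f1 f2) T"
  shows "(\<forall>S\<in>L2_bounded_ops M.
            (S \<in> L2_Deddens_algebra M T \<longleftrightarrow>
              (\<exists>g\<in>L2 M. \<not> L2_eq M g (\<lambda>x. 0) \<and>
                 L2_majorizes M (L2_tensor M g f2) (L2_tensor M g (L2_adjoint M S f2)))) \<and>
            (S \<in> L2_Deddens_algebra M T \<longleftrightarrow>
              (\<exists>C>0. \<forall>h\<in>L2 M. cmod (LINT x|M. h x * cnj (L2_adjoint M S f2 x))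
                 \<le> C * cmod (LINT x|M. h x * cnj (f2 x))))) \<and>
         L2_spectral_radius_algebra M T = {S \<in> L2_bounded_ops M. L2_eigenvector M (L2_adjoint M S) f2} \<and>
         {S \<in> L2_bounded_ops M. L2_eigenvector M (L2_adjoint M S) f2}
           = L2_spectral_radius_algebra M (L2_tensor M f1 f2)"
proof -
  note r1 = L2_rank_one_if_majorized[OF assms(2,4,5,8,9,10)]
  obtain g where "L2_rank_one M g f2 T" using r1(3) by blast
  then interpret T: L2_rank_one M g f2 T .
  \<comment> \<open>The description of the spectral radius algebra mentions only the second vector
    \<open>f2\<close>, so the two instances yield the same set.\<close>
  interpret f: L2_rank_one M f1 f2 "L2_tensor M f1 f2"
    by (rule L2_rank_one_tensor[OF assms(2,4,5) r1(1,2)])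
  have pos: "\<not> L2_eq M k (\<lambda>x. 0) \<longleftrightarrow> L2_norm M k > 0" if "k \<in> L2 M" for k
    using L2_norm_eq_0_iff[OF that] L2_norm_nonneg[of M k] by linarith
  have "(\<exists>g\<in>L2 M. \<not> L2_eq M g (\<lambda>x. 0) \<and>
        L2_majorizes M (L2_tensor M g f2) (L2_tensor M g (L2_adjoint M S f2)))
      \<longleftrightarrow> (\<exists>C>0. \<forall>h\<in>L2 M. cmod (L2_inner M h (L2_adjoint M S f2)) \<le> C * cmod (L2_inner M h f2))" for S
  proof -
    have "(\<exists>g\<in>L2 M. \<not> L2_eq M g (\<lambda>x. 0) \<and>
        L2_majorizes M (L2_tensor M g f2) (L2_tensor M g (L2_adjoint M S f2)))
      \<longleftrightarrow> (\<exists>g\<in>L2 M. L2_norm M g > 0 \<and>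
        (\<exists>C>0. \<forall>h\<in>L2 M. cmod (L2_inner M h (L2_adjoint M S f2)) \<le> C * cmod (L2_inner M h f2)))"
      by (intro bex_cong refl) (simp add: pos L2_majorizes_tensor_iff cong: conj_cong)
    \<comment> \<open>The witness for the existence of a nonzero \<open>g\<close> is
      \<open>f2\<close> itself.\<close>
    then show ?thesis using assms(5) r1(2) by blast
  qed
  note maj = this
  show ?thesis
    unfolding maj L2_inner_def[symmetric]
    by (intro conjI ballI T.Deddens_algebra_iff T.spectral_radius_algebra_eq
        f.spectral_radius_algebra_eq[symmetric])
qed

end
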